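(* Let $N\in\mathbb{N}$, $\gamma,\delta\in[0,+\infty)$, $1\le n\le N$ and $\lambda(x)=x(x+\gamma+\delta+1)$. The $2n$ roots of the polynomial $x\mapsto R_n(\lambda(x);\gamma,\delta,N)$, where $R_n$ is the Dual Hahn polynomial, are real and simple, $n$ of them, $x_1<\dots<x_n$, lie in $(0,N)$ and the other $n$ lie in $(-N-\gamma-\delta-1,-\gamma-\delta-1)$, and their mutual distances are greater than $1$. They form the unique $(n,n)$-equilibrium distribution, with exclusion radius $h=1$, in $(0,N)\cup(-N-\gamma-\delta-1,-\gamma-\delta-1)$ under the external field $\phi^R$ with force $$F_{\phi^R}(x)=-(\phi^R)'(x)=\frac12\log\frac{(x+\gamma+1)(x+\gamma+\delta+1)(N-x)(2x+\gamma+\delta)}{x(x+\gamma+\delta+N+1)(x+\delta)(2x+\gamma+\delta+2)}.$$ Moreover, for fixed $n,\gamma,\delta$, the positive roots $x_1<\dots<x_n$ are increasing functions of $N$.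
   Context: Dual Hahn polynomials: $R_n(\lambda(x);\gamma,\delta,N)=\sum_{k=0}^n\frac{(-n)_k(-x)_k(x+\gamma+\delta+1)_k}{k!\,(\gamma+1)_k(-N)_k}$, a polynomial of degree $n$ in $\lambda(x)=x(x+\gamma+\delta+1)$, where $(u)_k=u(u+1)\cdots(u+k-1)$ is the Pochhammer symbol. $(n,n)$-equilibrium distribution with $h=1$ in $(a,b)\cup(c,d)$: the unit-charge potential is $V_x(y)=\frac{x-y}{2}\log\left(\frac{y-x+1}{y-x-1}\right)-\frac12\log\big((y-x+1)(y-x-1)\big)$ for $|y-x|>1$, the energy is $\mathcal{E}_\phi(x_1,\dots,x_{2n})=\sum_{j\neq k}V_{x_k}(x_j)+2\sum_{j=1}^{2n}\phi(x_j)$, and an $(n,n)$-equilibrium distribution minimizes $\mathcal{E}_\phi$ among all $x_1,\dots,x_n\in(a,b)$, $x_{n+1},\dots,x_{2n}\in(c,d)$ with $|x_j-x_k|>1$ for $j\neq k$ (uniqueness is up to relabelling of the points inside each interval). *)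

theory Defs
  imports "HOL-Analysis.Analysis" "HOL-Computational_Algebra.Polynomial"
begin

section \<open>Dual Hahn polynomials\<close>

text \<open>The polynomial \<open>x \<mapsto> R\<^sub>n(\<lambda>(x); \<gamma>, \<delta>, N)\<close> in the variable \<open>x\<close>; \<open>[:0, -1:]\<close> is \<open>-x\<close> and
  \<open>[:\<gamma> + \<delta> + 1, 1:]\<close> is \<open>x + \<gamma> + \<delta> + 1\<close>.\<close>

definition dual_hahn_lambda :: "nat \<Rightarrow> real \<Rightarrow> real \<Rightarrow> nat \<Rightarrow> real poly" where
  "dual_hahn_lambda n \<gamma> \<delta> N =
     (\<Sum>k\<le>n. smult (pochhammer (- real n) k / (fact k * pochhammer (\<gamma> + 1) k * pochhammer (- real N) k))
        (pochhammer [:0, -1:] k * pochhammer [:\<gamma> + \<delta> + 1, 1:] k))"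

lemma poly_pochhammer: "poly (pochhammer p k) x = pochhammer (poly p x) k"
  for x :: "'a::comm_ring_1"
  by (induction k) (simp_all add: pochhammer_Suc)

lemma poly_dual_hahn_lambda:
  "poly (dual_hahn_lambda n \<gamma> \<delta> N) x =
     (\<Sum>k\<le>n. pochhammer (- real n) k * pochhammer (- x) k * pochhammer (x + \<gamma> + \<delta> + 1) k /
        (fact k * pochhammer (\<gamma> + 1) k * pochhammer (- real N) k))"
  by (simp add: dual_hahn_lambda_def poly_sum poly_pochhammer algebra_simps)

text \<open>It is indeed a polynomial of degree \<open>n\<close> in \<open>\<lambda>(x) = x(x + \<gamma> + \<delta> + 1)\<close>.\<close>

lemma pochhammer_lambda:
  "pochhammer [:0, -1:] k * pochhammer [:s, 1:] k =
     pcompose (\<Prod>i<k. [:real i * (real i + s), -1:]) [:0, s, 1:]"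
proof (induction k)
  case (Suc k)
  have "pochhammer [:0, -1:] (Suc k) * pochhammer [:s, 1:] (Suc k) =
    (pochhammer [:0, -1:] k * pochhammer [:s, 1:] k) * (([:0, -1:] + of_nat k) * ([:s, 1:] + of_nat k))"
    by (simp only: pochhammer_Suc mult_ac)
  moreover have "([:0, -1:] + of_nat k) * ([:s, 1:] + of_nat k) =
      pcompose [:real k * (real k + s), -1:] [:0, s, 1:]"
    by (simp add: of_nat_poly pcompose_pCons algebra_simps)
  ultimately show ?case
    by (simp only: Suc prod.lessThan_Suc pcompose_mult)
qed (simp add: pcompose_1)

lemma dual_hahn_lambda_pcompose:
  assumes "0 \<le> \<gamma>" "n \<le> N"
  shows "\<exists>R. degree R = n \<and> dual_hahn_lambda n \<gamma> \<delta> N = pcompose R [:0, \<gamma> + \<delta> + 1, 1:]"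
proof -
  define c where "c k = pochhammer (- real n) k / (fact k * pochhammer (\<gamma> + 1) k * pochhammer (- real N) k)" for k
  define q where "q k = (\<Prod>i<k. [:real i * (real i + (\<gamma> + \<delta> + 1)), -1:])" for k
  define R where "R = (\<Sum>k\<le>n. smult (c k) (q k))"
  have deg: "degree (q k) = k" for k
    unfolding q_def by (subst degree_prod_eq_sum_degree) auto
  have "c n \<noteq> 0"
  proof -
    have "pochhammer (- real n) n \<noteq> 0" "pochhammer (- real N) n \<noteq> 0"
      using assms(2) by (auto simp: pochhammer_eq_0_iff)
    moreover have "pochhammer (\<gamma> + 1) n \<noteq> 0"
      using assms(1) pochhammer_pos[of "\<gamma> + 1" n] by simp
    ultimately show ?thesis by (simp add: c_def)
  qed
  have q0: "q n \<noteq> 0" by (simp add: q_def)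
  have "coeff R n = c n * lead_coeff (q n)"
  proof -
    have "coeff R n = (\<Sum>k\<le>n. c k * coeff (q k) n)" by (simp add: R_def coeff_sum)
    also have "\<dots> = (\<Sum>k\<in>{n}. c k * coeff (q k) n)"
      by (rule sum.mono_neutral_right) (auto intro!: coeff_eq_0 simp: deg)
    finally show ?thesis by (simp add: deg)
  qed
  then have "coeff R n \<noteq> 0" using \<open>c n \<noteq> 0\<close> q0 by (simp add: leading_coeff_0_iff)
  moreover have "degree R \<le> n"
    unfolding R_def by (rule degree_sum_le) (auto simp: deg intro: order.trans[OF degree_smult_le])
  ultimately have "degree R = n" by (simp add: le_antisym le_degree)
  moreover have "dual_hahn_lambda n \<gamma> \<delta> N = pcompose R [:0, \<gamma> + \<delta> + 1, 1:]"
    by (simp add: dual_hahn_lambda_def pochhammer_lambda R_def c_def q_def pcompose_sum pcompose_smult)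
  ultimately show ?thesis by blast
qed

definition dual_hahn_roots :: "nat \<Rightarrow> real \<Rightarrow> real \<Rightarrow> nat \<Rightarrow> real set" where
  "dual_hahn_roots n \<gamma> \<delta> N = {x. poly (dual_hahn_lambda n \<gamma> \<delta> N) x = 0}"

text \<open>The \<open>j\<close>-th smallest root in \<open>(0, N)\<close>, for \<open>1 \<le> j \<le> n\<close>.\<close>

definition positive_root :: "nat \<Rightarrow> real \<Rightarrow> real \<Rightarrow> nat \<Rightarrow> nat \<Rightarrow> real" where
  "positive_root n \<gamma> \<delta> N j = sorted_list_of_set (dual_hahn_roots n \<gamma> \<delta> N \<inter> {0<..<real N}) ! (j - 1)"


section \<open>Equilibrium distributions with exclusion radius 1\<close>

definition pair_potential :: "real \<Rightarrow> real \<Rightarrow> real" where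
  "pair_potential x y =
     (x - y) / 2 * ln ((y - x + 1) / (y - x - 1)) - 1 / 2 * ln ((y - x + 1) * (y - x - 1))"

definition energy :: "(real \<Rightarrow> real) \<Rightarrow> nat \<Rightarrow> (nat \<Rightarrow> real) \<Rightarrow> real" where
  "energy \<phi> m x =
     (\<Sum>j\<in>{1..m}. \<Sum>k\<in>{1..m} - {j}. pair_potential (x k) (x j)) + 2 * (\<Sum>j\<in>{1..m}. \<phi> (x j))"

definition admissible :: "nat \<Rightarrow> real \<Rightarrow> real \<Rightarrow> real \<Rightarrow> real \<Rightarrow> (nat \<Rightarrow> real) \<Rightarrow> bool" where
  "admissible n a b c d x \<longleftrightarrow>
     (\<forall>j\<in>{1..n}. x j \<in> {a<..<b}) \<and> (\<forall>j\<in>{n+1..2*n}. x j \<in> {c<..<d}) \<and>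
     (\<forall>j\<in>{1..2*n}. \<forall>k\<in>{1..2*n}. j \<noteq> k \<longrightarrow> \<bar>x j - x k\<bar> > 1)"

definition equilibrium_distribution ::
    "(real \<Rightarrow> real) \<Rightarrow> nat \<Rightarrow> real \<Rightarrow> real \<Rightarrow> real \<Rightarrow> real \<Rightarrow> (nat \<Rightarrow> real) \<Rightarrow> bool" where
  "equilibrium_distribution \<phi> n a b c d x \<longleftrightarrow>
     admissible n a b c d x \<and>
     (\<forall>y. admissible n a b c d y \<longrightarrow> energy \<phi> (2 * n) x \<le> energy \<phi> (2 * n) y)"

definition dual_hahn_force :: "real \<Rightarrow> real \<Rightarrow> nat \<Rightarrow> real \<Rightarrow> real" where
  "dual_hahn_force \<gamma> \<delta> N x =
     1 / 2 * ln (((x + \<gamma> + 1) * (x + \<gamma> + \<delta> + 1) * (real N - x) * (2 * x + \<gamma> + \<delta>)) /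
                 (x * (x + \<gamma> + \<delta> + real N + 1) * (x + \<delta>) * (2 * x + \<gamma> + \<delta> + 2)))"

text \<open>A field with this force is determined only up to an additive constant on each of the two
  intervals; each interval carries exactly \<open>n\<close> points, so these constants do not affect the
  minimizers.\<close>

definition dual_hahn_field :: "real \<Rightarrow> real \<Rightarrow> nat \<Rightarrow> (real \<Rightarrow> real) \<Rightarrow> bool" where
  "dual_hahn_field \<gamma> \<delta> N \<phi> \<longleftrightarrow>
     (\<forall>x \<in> {0<..<real N} \<union> {- real N - \<gamma> - \<delta> - 1<..<- \<gamma> - \<delta> - 1}.
        (\<phi> has_real_derivative - dual_hahn_force \<gamma> \<delta> N x) (at x))"

lemma dual_hahn_field_exists:
  assumes "0 \<le> \<gamma>" "0 \<le> \<delta>"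
  shows "\<exists>\<phi>. dual_hahn_field \<gamma> \<delta> N \<phi>"
proof -
  define G where "G u = u * ln u - u" for u :: real
  have G: "(G has_real_derivative ln u) (at u)" if "u \<noteq> 0" for u
  proof (cases "u > 0")
    case True
    then show ?thesis unfolding G_def by (auto intro!: derivative_eq_intros)
  next
    case False
    with that have "- u > 0" by simp
    then have "((\<lambda>u. u * ln (- u) - u) has_real_derivative ln (- u)) (at u)"
      by (auto intro!: derivative_eq_intros simp: field_simps)
    then show ?thesis by (simp add: G_def[abs_def] ln_minus)
  qed
  have L: "((\<lambda>x. G (a * x + b)) has_real_derivative a * ln (a * x + b)) (at x)" if "a * x + b \<noteq> 0" for a b x
    by (rule DERIV_cong, rule DERIV_chain2[where f = G and g = "\<lambda>x. a * x + b", OF G[OF that]]) (auto intro!: derivative_eq_intros)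
  define \<phi> where "\<phi> x = - 1 / 2 * (G (x + \<gamma> + 1) + G (x + \<gamma> + \<delta> + 1) - G (real N - x)
      + G (2 * x + \<gamma> + \<delta>) / 2 - G x - G (x + \<gamma> + \<delta> + real N + 1) - G (x + \<delta>)
      - G (2 * x + \<gamma> + \<delta> + 2) / 2)" for x
  have "(\<phi> has_real_derivative - dual_hahn_force \<gamma> \<delta> N x) (at x)"
    if "x \<in> {0<..<real N} \<union> {- real N - \<gamma> - \<delta> - 1<..<- \<gamma> - \<delta> - 1}" for x
  proof -
    have nz: "x + \<gamma> + 1 \<noteq> 0" "x + \<gamma> + \<delta> + 1 \<noteq> 0" "real N - x \<noteq> 0" "2 * x + \<gamma> + \<delta> \<noteq> 0" "x \<noteq> 0"
      "x + \<gamma> + \<delta> + real N + 1 \<noteq> 0" "x + \<delta> \<noteq> 0" "2 * x + \<gamma> + \<delta> + 2 \<noteq> 0"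
      using that assms by auto
    note D = L[of 1 x "\<gamma> + 1"] L[of 1 x "\<gamma> + \<delta> + 1"] L[of "- 1" x "real N"] L[of 2 x "\<gamma> + \<delta>"] L[of 1 x 0]
      L[of 1 x "\<gamma> + \<delta> + real N + 1"] L[of 1 x \<delta>] L[of 2 x "\<gamma> + \<delta> + 2"]
    have D: "((\<lambda>x. G (x + \<gamma> + 1)) has_real_derivative ln (x + \<gamma> + 1)) (at x)"
      "((\<lambda>x. G (x + \<gamma> + \<delta> + 1)) has_real_derivative ln (x + \<gamma> + \<delta> + 1)) (at x)"
      "((\<lambda>x. G (real N - x)) has_real_derivative - ln (real N - x)) (at x)"
      "((\<lambda>x. G (2 * x + \<gamma> + \<delta>)) has_real_derivative 2 * ln (2 * x + \<gamma> + \<delta>)) (at x)"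
      "(G has_real_derivative ln x) (at x)"
      "((\<lambda>x. G (x + \<gamma> + \<delta> + real N + 1)) has_real_derivative ln (x + \<gamma> + \<delta> + real N + 1)) (at x)"
      "((\<lambda>x. G (x + \<delta>)) has_real_derivative ln (x + \<delta>)) (at x)"
      "((\<lambda>x. G (2 * x + \<gamma> + \<delta> + 2)) has_real_derivative 2 * ln (2 * x + \<gamma> + \<delta> + 2)) (at x)"
      using D nz by (simp_all add: add.assoc)
    have F: "dual_hahn_force \<gamma> \<delta> N x =
        1 / 2 * (ln (x + \<gamma> + 1) + ln (x + \<gamma> + \<delta> + 1) + ln (real N - x) + ln (2 * x + \<gamma> + \<delta>)
        - (ln x + ln (x + \<gamma> + \<delta> + real N + 1) + ln (x + \<delta>) + ln (2 * x + \<gamma> + \<delta> + 2)))"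
      unfolding dual_hahn_force_def using nz by (simp only: ln_mult ln_div mult_eq_0_iff simp_thms if_True)
    show ?thesis
      unfolding \<phi>_def[abs_def] F
      by (rule DERIV_cong[OF DERIV_cmult[OF DERIV_diff[OF DERIV_diff[OF DERIV_diff[OF DERIV_diff[OF
            DERIV_add[OF DERIV_diff[OF DERIV_add[OF D(1) D(2)] D(3)] DERIV_cdivide[OF D(4)]]
            D(5)] D(6)] D(7)] DERIV_cdivide[OF D(8)]]]]) (simp add: field_simps)
  qed
  then show ?thesis unfolding dual_hahn_field_def by blast
qed

end

theory Submission
  imports Defs "HOL-Computational_Algebra.Fundamental_Theorem_Algebra"
begin

text \<open>In the variable \<open>x\<close> the polynomial \<open>Y(x) = R\<^sub>n(\<lambda>(x))\<close> satisfies
  \<open>B(x) (Y(x + 1) - Y(x)) + D(x) (Y(x - 1) - Y(x)) = - n Y(x)\<close>. The left-hand side is self-adjoint for a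
  positive weight on \<open>{0, \<dots>, N}\<close>, so \<open>R\<^sub>n\<close> is orthogonal to all polynomials in \<open>\<lambda>\<close> of lower degree; testing
  it against cofactors of itself locates its roots, at most one in each cell \<open>[m, m + 1]\<close>. A sign argument in
  the difference equation then improves this to distances greater than 1. At a root the difference equation
  becomes \<open>B(x) Y(x + 1) = - D(x) Y(x - 1)\<close>, whose logarithm says that the forces on that root balance. For a
  fixed ordering of the points the energy is strictly convex, so this critical point is its only minimizer.
  Monotonicity in \<open>N\<close> is a discrete maximum principle for the balance equations.\<close>

section \<open>Real polynomials and their complex roots\<close>

text \<open>Orthogonality alone cannot separate the roots: with one root per cell, two roots may
  still lie close together on either side of a grid point. Strict convexity of the energy comes from
  the external field, whose force strictly decreases on each interval; the pair potential does not
  see common translations. The reflection \<open>x -> - x - \<sigma>\<close> with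
  \<open>\<sigma> = \<gamma> + \<delta> + 1\<close> fixes \<open>\<lambda>(x)\<close>, exchanges the
  two intervals, swaps \<open>B\<close> and \<open>D\<close> and reverses the force, so that
  estimates are needed on the positive side only. In the maximum principle the mirror images are the
  obstacle: as a root moves right, its image moves left, and their effects on another positive root
  are opposed; only the sum is monotone.\<close>

abbreviation cpoly :: "real poly \<Rightarrow> complex poly" where
  "cpoly \<equiv> map_poly complex_of_real"

lemma cpoly_mult: "cpoly (p * q) = cpoly p * cpoly q"
  by (rule poly_eqI) (simp add: coeff_map_poly coeff_mult)

lemma cpoly_add: "cpoly (p + q) = cpoly p + cpoly q"
  by (rule poly_eqI) (simp add: coeff_map_poly)

lemma degree_cpoly: "degree (cpoly p) = degree p"
  by (simp add: degree_map_poly)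

lemma cpoly_of_real: "poly (cpoly p) (complex_of_real x) = complex_of_real (poly p x)"
  by (induction p) (simp_all add: map_poly_pCons)

text \<open>The quadratic is \<open>(x - z) (x - cnj z)\<close>. The remainder of \<open>p\<close>
  modulo it is a real polynomial of degree at most 1 that vanishes at the nonreal point
  \<open>z\<close>, hence is zero.\<close>

lemma complex_root_quadratic_factor:
  assumes "poly (cpoly p) z = 0" "Im z \<noteq> 0"
  shows "[:(cmod z)\<^sup>2, - 2 * Re z, 1:] dvd p"
proof -
  define f where "f = [:(cmod z)\<^sup>2, - 2 * Re z, 1:]"
  have "degree (p mod f) < 2"
    using degree_mod_less[of f p] by (auto simp: f_def)
  then have "p mod f = [:coeff (p mod f) 0, coeff (p mod f) 1:]"
    by (intro poly_eqI) (auto simp: coeff_pCons coeff_eq_0 split: nat.split)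
  then obtain u v where uv: "p mod f = [:u, v:]" by blast
  have f0: "poly (cpoly f) z = 0"
    unfolding f_def cmod_power2 by (simp add: map_poly_pCons complex_eq_iff power2_eq_square algebra_simps)
  have "p = f * (p div f) + p mod f" by simp
  then have "p = f * (p div f) + [:u, v:]" using uv by simp
  then have "poly (cpoly p) z = poly (cpoly (f * (p div f))) z + poly (cpoly [:u, v:]) z"
    using cpoly_add[of "f * (p div f)" "[:u, v:]"] by (metis poly_add)
  then have "of_real u + of_real v * z = 0"
    using assms(1) f0 by (simp add: cpoly_mult map_poly_pCons mult.commute)
  then have "u = 0" "v = 0" using assms(2) by (auto simp: complex_eq_iff)
  then show ?thesis using uv unfolding f_def by (simp add: mod_eq_0_iff_dvd)
qed

lemma linear_factors_dvd:
  fixes p :: "real poly"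
  assumes "finite S" "\<And>r. r \<in> S \<Longrightarrow> poly p r = 0"
  shows "(\<Prod>r\<in>S. [:- r, 1:]) dvd p"
  using assms
proof (induction S)
  case (insert a S)
  then obtain q where q: "p = (\<Prod>r\<in>S. [:- r, 1:]) * q" by (auto elim: dvdE)
  have "poly (\<Prod>r\<in>S. [:- r, 1:]) a \<noteq> 0" using insert.hyps by (auto simp: poly_prod)
  then have "poly q a = 0" using insert.prems[of a] by (simp add: q)
  then have "[:- a, 1:] dvd q" by (simp add: poly_eq_0_iff_dvd)
  then show ?case
    unfolding q prod.insert[OF insert.hyps] mult.commute[of _ q] by (rule mult_dvd_mono) simp
qed simp

section \<open>Strict convexity and energies\<close>

text \<open>By the mean value theorem the chord has slope \<open>f' t\<close> with \<open>t\<close>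
  strictly between \<open>x\<close> and \<open>y\<close>, and monotonicity of \<open>f'\<close> puts
  \<open>f y\<close> above the tangent. Convexity enters the proof only in this form, so no Hessian
  of the energy is formed.\<close>

lemma strict_tangent:
  fixes f f' :: "real \<Rightarrow> real"
  assumes deriv: "\<And>t. t \<in> S \<Longrightarrow> (f has_real_derivative f' t) (at t)"
    and mono: "\<And>s t. s \<in> S \<Longrightarrow> t \<in> S \<Longrightarrow> s < t \<Longrightarrow> f' s < f' t"
    and S: "is_interval S" "x \<in> S" "y \<in> S" "x \<noteq> y"
  shows "f x + f' x * (y - x) < f y"
proof -
  have between: "t \<in> S" if "min x y \<le> t" "t \<le> max x y" for t
    using S that unfolding is_interval_1 by (metis max_def min_def)
  show ?thesis
  proof (cases "x < y")
    case True
    have "(f has_real_derivative f' t) (at t)" if "x \<le> t" "t \<le> y" for t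
      using that by (intro deriv between) auto
    from MVT2[OF True this] obtain t where t: "x < t" "t < y" "f y - f x = (y - x) * f' t" by blast
    have "f' x < f' t" using t S between[of t] by (intro mono) auto
    then have "(y - x) * f' x < (y - x) * f' t" using True by simp
    then show ?thesis using t(3) by (simp add: mult.commute)
  next
    case False
    then have yx: "y < x" using S(4) by simp
    have "(f has_real_derivative f' t) (at t)" if "y \<le> t" "t \<le> x" for t
      using that by (intro deriv between) auto
    from MVT2[OF yx this] obtain t where t: "y < t" "t < x" "f x - f y = (x - y) * f' t" by blast
    have "f' t < f' x" using t S between[of t] by (intro mono) auto
    then have "(x - y) * f' t < (x - y) * f' x" using yx by simp
    then show ?thesis using t(3) by (simp add: algebra_simps)
  qed
qed

text \<open>Minus the derivative of \<open>pair_potential 0\<close> for \<open>u > 1\<close>,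
  extended to an odd function: the force on a point by another in terms of their signed
  separation.\<close>

definition pair_force :: "real \<Rightarrow> real" where
  "pair_force u = 1 / 2 * ln ((u + 1) / (u - 1))"

lemma pair_force_odd: "pair_force (- u) = - pair_force u"
proof -
  have "(- u + 1) / (- u - 1) = inverse ((u + 1) / (u - 1))"
    by (simp add: divide_simps) (auto simp: algebra_simps)
  then show ?thesis unfolding pair_force_def by (simp only: ln_inverse)
qed

text \<open>A junk value (\<open>ln (- 1)\<close>), but it lets sums over pairs include the diagonal.\<close>

lemma pair_force_0: "pair_force 0 = 0"
  using pair_force_odd[of 0] by simp

lemma pair_force_decreasing:
  assumes "1 < u" "u < v"
  shows "pair_force v < pair_force u"
proof -
  have "(v + 1) / (v - 1) < (u + 1) / (u - 1)"
    using assms by (simp add: divide_simps) (simp add: algebra_simps)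
  then show ?thesis using assms by (simp add: pair_force_def)
qed

lemma pair_potential_mirror: "pair_potential 0 (- u) = pair_potential 0 u"
proof -
  have "(- u + 1) / (- u - 1) = inverse ((u + 1) / (u - 1))"
    by (simp add: divide_simps) (auto simp: algebra_simps)
  moreover have "(- u + 1) * (- u - 1) = (u + 1) * (u - 1)" by (simp add: algebra_simps)
  ultimately show ?thesis unfolding pair_potential_def
    by (simp only: diff_0_right ln_inverse) simp
qed

lemma pair_potential_diff: "pair_potential x y = pair_potential 0 (y - x)"
  by (simp add: pair_potential_def)

lemma pair_potential_deriv:
  assumes "1 < u"
  shows "(pair_potential 0 has_real_derivative - pair_force u) (at u)"
proof -
  have eq: "pair_potential 0 t = - 1 / 2 * ((t + 1) * ln (t + 1) - (t - 1) * ln (t - 1))" if "t \<in> {1<..}" for t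
    using that by (simp add: pair_potential_def ln_div ln_mult) (simp add: field_simps)
  have "((\<lambda>t. - 1 / 2 * ((t + 1) * ln (t + 1) - (t - 1) * ln (t - 1))) has_real_derivative
      - 1 / 2 * (ln (u + 1) - ln (u - 1))) (at u)"
    using assms by (auto intro!: derivative_eq_intros)
  then have "(pair_potential 0 has_real_derivative - 1 / 2 * (ln (u + 1) - ln (u - 1))) (at u)"
    by (rule has_field_derivative_transform_within_open[of _ _ _ "{1<..}"]) (use assms eq in auto)
  then show ?thesis using assms by (simp add: pair_force_def ln_div)
qed

text \<open>Convexity holds on each of the rays \<open>u > 1\<close> and \<open>u < - 1\<close> but
  not across the gap between them; hence the requirement of equal signs.\<close>

lemma pair_potential_tangent:
  assumes "1 < \<bar>u\<bar>" "1 < \<bar>v\<bar>" "0 < u \<longleftrightarrow> 0 < v"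
  shows "pair_potential 0 u - pair_force u * (v - u) \<le> pair_potential 0 v"
proof -
  have pos: "pair_potential 0 u - pair_force u * (v - u) \<le> pair_potential 0 v" if "1 < u" "1 < v" for u v
  proof (cases "u = v")
    case False
    have "pair_potential 0 u + - pair_force u * (v - u) < pair_potential 0 v"
      by (rule strict_tangent[of "{1<..}"])
        (use that False in \<open>auto intro: pair_potential_deriv pair_force_decreasing simp: is_interval_1\<close>)
    then show ?thesis by simp
  qed simp
  show ?thesis
  proof (cases "0 < u")
    case True then show ?thesis using assms pos[of u v] by auto
  next
    case False
    then have "pair_potential 0 (- u) - pair_force (- u) * (- v - - u) \<le> pair_potential 0 (- v)"
      using assms by (intro pos) auto
    then show ?thesis unfolding pair_potential_mirror pair_force_odd by (simp add: algebra_simps)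
  qed
qed

text \<open>Shows that the energy depends on the set of points alone, so all labellings of one set
  have equal energy.\<close>

lemma energy_reindex:
  assumes "bij_betw x {1..m} A"
  shows "energy \<phi> m x = (\<Sum>a\<in>A. \<Sum>c\<in>A - {a}. pair_potential c a) + 2 * (\<Sum>a\<in>A. \<phi> a)"
proof -
  have "(\<Sum>k\<in>{1..m} - {j}. pair_potential (x k) (x j)) = (\<Sum>c\<in>A - {x j}. pair_potential c (x j))"
    if "j \<in> {1..m}" for j
  proof (rule sum.reindex_bij_betw)
    show "bij_betw x ({1..m} - {j}) (A - {x j})"
      using that assms inj_on_image_set_diff[of x "{1..m}" "{1..m}" "{j}"]
      by (auto simp: bij_betw_def inj_on_diff)
  qed
  then have "(\<Sum>j\<in>{1..m}. \<Sum>k\<in>{1..m} - {j}. pair_potential (x k) (x j)) =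
     (\<Sum>j\<in>{1..m}. \<Sum>c\<in>A - {x j}. pair_potential c (x j))"
    by simp
  also have "\<dots> = (\<Sum>a\<in>A. \<Sum>c\<in>A - {a}. pair_potential c a)"
    by (rule sum.reindex_bij_betw[OF assms, of "\<lambda>a. \<Sum>c\<in>A - {a}. pair_potential c a"])
  finally show ?thesis using sum.reindex_bij_betw[OF assms, of \<phi>] by (simp add: energy_def)
qed

text \<open>Add up the tangent inequalities at \<open>z\<close>. Balance of the forces cancels the
  first-order terms, and strictness comes from the field term of a point where \<open>y\<close> and
  \<open>z\<close> differ. The equal ordering \<open>ord\<close> keeps each pair on one convexity
  ray.\<close>

lemma critical_energy_less:
  fixes y z F :: "_ \<Rightarrow> real"
  assumes sep: "\<And>j k. j \<in> {1..m} \<Longrightarrow> k \<in> {1..m} \<Longrightarrow> j \<noteq> k \<Longrightarrow> 1 < \<bar>z j - z k\<bar> \<and> 1 < \<bar>y j - y k\<bar>"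
    and ord: "\<And>j k. j \<in> {1..m} \<Longrightarrow> k \<in> {1..m} \<Longrightarrow> z j < z k \<longleftrightarrow> y j < y k"
    and tangent: "\<And>j. j \<in> {1..m} \<Longrightarrow> y j \<noteq> z j \<Longrightarrow> \<phi> (z j) - F (z j) * (y j - z j) < \<phi> (y j)"
    and critical: "\<And>j. j \<in> {1..m} \<Longrightarrow> (\<Sum>k\<in>{1..m} - {j}. pair_force (z j - z k)) = - F (z j)"
    and ne: "j0 \<in> {1..m}" "y j0 \<noteq> z j0"
  shows "energy \<phi> m z < energy \<phi> m y"
proof -
  let ?M = "{1..m}"
  define e where "e j = y j - z j" for j
  define p where "p j k = pair_force (z j - z k)" for j k
  have crit: "(\<Sum>k\<in>?M. p j k) = - F (z j)" if "j \<in> ?M" for j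
    using critical[OF that] sum.remove[OF finite_atLeastAtMost that, of "p j"]
    by (simp add: p_def pair_force_0)
  have p_odd: "p j k = - p k j" for j k
    using pair_force_odd[of "z k - z j"] by (simp add: p_def)
  have "(\<Sum>j\<in>?M. \<Sum>k\<in>?M. p j k * (e j - e k)) =
      (\<Sum>j\<in>?M. e j * (\<Sum>k\<in>?M. p j k)) - (\<Sum>j\<in>?M. \<Sum>k\<in>?M. p j k * e k)"
    by (simp add: sum_distrib_left sum_subtractf[symmetric] algebra_simps)
  \<comment> \<open>Exchanging \<open>j\<close> and \<open>k\<close> and oddness make the second
    half equal to the first; the resulting factor 2 matches that of the field in the energy.\<close>
  also have "(\<Sum>j\<in>?M. \<Sum>k\<in>?M. p j k * e k) = (\<Sum>k\<in>?M. \<Sum>j\<in>?M. p j k * e k)"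
    by (rule sum.swap)
  also have "\<dots> = - (\<Sum>k\<in>?M. e k * (\<Sum>j\<in>?M. p k j))"
    by (subst p_odd) (simp add: sum_distrib_left sum_negf[symmetric] algebra_simps)
  finally have total: "(\<Sum>j\<in>?M. \<Sum>k\<in>?M. p j k * (e j - e k)) = - 2 * (\<Sum>j\<in>?M. F (z j) * e j)"
    using crit by (simp add: sum_negf mult.commute)
  have pairs: "(\<Sum>j\<in>?M. \<Sum>k\<in>?M - {j}. pair_potential (z k) (z j)) - (\<Sum>j\<in>?M. \<Sum>k\<in>?M. p j k * (e j - e k))
      \<le> (\<Sum>j\<in>?M. \<Sum>k\<in>?M - {j}. pair_potential (y k) (y j))"
  proof -
    have "(\<Sum>k\<in>?M - {j}. pair_potential (z k) (z j)) - (\<Sum>k\<in>?M. p j k * (e j - e k))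
        \<le> (\<Sum>k\<in>?M - {j}. pair_potential (y k) (y j))" if j: "j \<in> ?M" for j
    proof -
      have "pair_potential (z k) (z j) - p j k * (e j - e k) \<le> pair_potential (y k) (y j)"
        if "k \<in> ?M - {j}" for k
        using pair_potential_tangent[of "z j - z k" "y j - y k"] sep[of j k] ord[of k j] j that
        by (simp add: pair_potential_diff[of "z k"] pair_potential_diff[of "y k"] p_def e_def algebra_simps)
      then have "(\<Sum>k\<in>?M - {j}. pair_potential (z k) (z j) - p j k * (e j - e k))
          \<le> (\<Sum>k\<in>?M - {j}. pair_potential (y k) (y j))"
        by (rule sum_mono)
      moreover have "(\<Sum>k\<in>?M. p j k * (e j - e k)) = (\<Sum>k\<in>?M - {j}. p j k * (e j - e k))"
        using sum.remove[OF finite_atLeastAtMost j, of "\<lambda>k. p j k * (e j - e k)"] by simp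
      ultimately show ?thesis by (simp only: sum_subtractf)
    qed
    then have "(\<Sum>j\<in>?M. (\<Sum>k\<in>?M - {j}. pair_potential (z k) (z j)) - (\<Sum>k\<in>?M. p j k * (e j - e k)))
        \<le> (\<Sum>j\<in>?M. \<Sum>k\<in>?M - {j}. pair_potential (y k) (y j))"
      by (rule sum_mono)
    then show ?thesis by (simp only: sum_subtractf)
  qed
  have "(\<Sum>j\<in>?M. \<phi> (z j) - F (z j) * e j) < (\<Sum>j\<in>?M. \<phi> (y j))"
  proof (rule sum_strict_mono_ex1)
    show "\<forall>j\<in>?M. \<phi> (z j) - F (z j) * e j \<le> \<phi> (y j)"
      using tangent by (force simp: e_def)
    show "\<exists>j\<in>?M. \<phi> (z j) - F (z j) * e j < \<phi> (y j)"
      using tangent ne by (force simp: e_def)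
  qed simp
  then show ?thesis
    using pairs unfolding energy_def total by (simp add: sum_subtractf)
qed

lemma order_matching:
  fixes y :: "'i \<Rightarrow> real" and A :: "real set"
  assumes "finite I" "inj_on y I" "finite A" "card A = card I"
  shows "\<exists>z. bij_betw z I A \<and> (\<forall>j\<in>I. \<forall>k\<in>I. z j < z k \<longleftrightarrow> y j < y k)"
proof -
  define rk where "rk j = card {k \<in> I. y k < y j}" for j
  define z where "z j = sorted_list_of_set A ! rk j" for j
  have rk: "rk j < card A" if "j \<in> I" for j
    unfolding rk_def assms(4) using that assms(1) by (intro psubset_card_mono) auto
  have less: "z j < z k" if "j \<in> I" "k \<in> I" "y j < y k" for j k
  proof -
    have "rk j < rk k" unfolding rk_def using that assms(1) by (intro psubset_card_mono) auto
    then show ?thesis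
      unfolding z_def using rk[OF that(2)] strict_sorted_list_of_set[of A]
      by (intro sorted_wrt_nth_less[of "(<)"]) auto
  qed
  have iff: "z j < z k \<longleftrightarrow> y j < y k" if "j \<in> I" "k \<in> I" for j k
    using less[of j k] less[of k j] that inj_onD[OF assms(2), of j k] by (cases "y j" "y k" rule: linorder_cases) auto
  have inj: "inj_on z I"
    by (rule inj_onI) (metis iff assms(2) inj_onD less_irrefl linorder_neqE_linordered_idom)
  have "z j \<in> A" if "j \<in> I" for j
    using nth_mem[of "rk j" "sorted_list_of_set A"] rk[OF that] assms(3) by (simp add: z_def)
  then have "z ` I \<subseteq> A" by auto
  then have "z ` I = A" using assms inj by (intro card_subset_eq) (auto simp: card_image)
  then show ?thesis using inj iff by (auto simp: bij_betw_def)
qed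

section \<open>The difference equation\<close>

locale dual_hahn =
  fixes n N :: nat and \<gamma> \<delta> :: real
  assumes gam: "0 \<le> \<gamma>" and del: "0 \<le> \<delta>" and n1: "1 \<le> n" and nN: "n \<le> N"
begin

definition \<sigma> :: real where "\<sigma> = \<gamma> + \<delta> + 1"

definition lam :: "real \<Rightarrow> real" where "lam x = x * (x + \<sigma>)"

text \<open>The numerators of the hypergeometric sum, on which \<open>L\<close> acts triangularly
  with a single lower term.\<close>

definition basis :: "nat \<Rightarrow> real \<Rightarrow> real" where
  "basis k x = pochhammer (- x) k * pochhammer (x + \<sigma>) k"

definition Y :: "real poly" where "Y = dual_hahn_lambda n \<gamma> \<delta> N"

text \<open>\<open>B\<close> and \<open>D\<close> are the coefficients of the classical dual Hahn
  difference equation, birth and death rates on \<open>{0, ..., N}\<close>. The numerators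
  \<open>b\<close> and \<open>d\<close> are kept apart because the reflection
  \<open>x -> - x - \<sigma>\<close> interchanges them.\<close>

definition b :: "real \<Rightarrow> real" where "b x = (x + \<gamma> + 1) * (x + \<sigma>) * (real N - x)"

definition d :: "real \<Rightarrow> real" where "d x = x * (x + \<sigma> + real N) * (x + \<delta>)"

definition B :: "real \<Rightarrow> real" where "B x = b x / ((2 * x + \<sigma>) * (2 * x + \<sigma> + 1))"

definition D :: "real \<Rightarrow> real" where "D x = d x / ((2 * x + \<sigma>) * (2 * x + \<sigma> - 1))"

definition L :: "(real \<Rightarrow> real) \<Rightarrow> real \<Rightarrow> real" where
  "L f x = B x * (f (x + 1) - f x) + D x * (f (x - 1) - f x)"

lemma sig1: "1 \<le> \<sigma>" using gam del by (simp add: \<sigma>_def)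

text \<open>The shift replaces the Pochhammer symbol at \<open>x + \<sigma>\<close> by the one at
  \<open>x + \<sigma> + 1\<close>. The factor \<open>x + \<sigma>\<close> of \<open>b\<close>
  converts it back without division.\<close>

lemma basis_forward:
  "b x * (basis (Suc k) (x + 1) - basis (Suc k) x) =
     - (real k + 1) * (2 * x + \<sigma> + 1) * (x + \<gamma> + 1) * (real N - x) * (x + \<sigma> + real k) * basis k x"
proof -
  define p q r where "p = pochhammer (- x) k" and "q = pochhammer (x + \<sigma>) k"
    and "r = pochhammer (x + \<sigma> + 1) k"
  have r: "(x + \<sigma>) * r = q * (x + \<sigma> + real k)"
    using pochhammer_rec[of "x + \<sigma>" k] pochhammer_Suc[of "x + \<sigma>" k] by (simp add: q_def r_def)
  have 1: "basis (Suc k) (x + 1) = - (x + 1) * p * (r * (x + \<sigma> + 1 + real k))"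
    using pochhammer_rec[of "- (x + 1)" k] pochhammer_Suc[of "x + 1 + \<sigma>" k]
    by (simp add: basis_def p_def r_def ac_simps)
  have 2: "basis (Suc k) x = p * (real k - x) * (q * (x + \<sigma> + real k))"
    by (simp add: basis_def p_def q_def pochhammer_Suc)
  have "(x + \<sigma>) * (basis (Suc k) (x + 1) - basis (Suc k) x) =
      - (x + 1) * p * (((x + \<sigma>) * r) * (x + \<sigma> + 1 + real k))
      - (x + \<sigma>) * (p * (real k - x) * (q * (x + \<sigma> + real k)))"
    unfolding 1 2 by algebra
  also have "\<dots> = - (real k + 1) * (2 * x + \<sigma> + 1) * (x + \<sigma> + real k) * (p * q)"
    unfolding r by algebra
  finally show ?thesis by (simp add: b_def basis_def p_def q_def)
qed

lemma reflection: "b (- x - \<sigma>) = d x" "basis k (- x - \<sigma>) = basis k x"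
  by (simp_all add: b_def d_def basis_def \<sigma>_def algebra_simps)

lemma basis_backward:
  "d x * (basis (Suc k) (x - 1) - basis (Suc k) x) =
     - (real k + 1) * (2 * x + \<sigma> - 1) * (x + \<delta>) * (real N + x + \<sigma>) * (real k - x) * basis k x"
proof -
  have "basis (Suc k) (- x - \<sigma> + 1) = basis (Suc k) (x - 1)"
    using reflection(2)[of "Suc k" "x - 1"] by (simp add: algebra_simps)
  then have "d x * (basis (Suc k) (x - 1) - basis (Suc k) x) =
     - (real k + 1) * (2 * (- x - \<sigma>) + \<sigma> + 1) * (- x - \<sigma> + \<gamma> + 1) * (real N - (- x - \<sigma>)) *
       (- x - \<sigma> + \<sigma> + real k) * basis k x"
    using basis_forward[of "- x - \<sigma>" k] by (simp add: reflection)
  also have "- x - \<sigma> + \<gamma> + 1 = - (x + \<delta>)" by (simp add: \<sigma>_def)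
  finally show ?thesis by (simp add: algebra_simps)
qed

text \<open>At \<open>x = 0\<close> the coefficient \<open>D\<close> vanishes, even when \<open>\<sigma> = 1\<close> turns it into \<open>0 / 0\<close>.\<close>

lemma L_basis_Suc:
  assumes "2 * x + \<sigma> \<noteq> 0" "2 * x + \<sigma> + 1 \<noteq> 0" "x = 0 \<or> 2 * x + \<sigma> - 1 \<noteq> 0"
  shows "L (basis (Suc k)) x =
    - (real k + 1) * basis (Suc k) x - (real k + 1) * (\<gamma> + real k + 1) * (real N - real k) * basis k x"
proof -
  have B: "B x * (basis (Suc k) (x + 1) - basis (Suc k) x) =
     - (real k + 1) * (x + \<gamma> + 1) * (real N - x) * (x + \<sigma> + real k) * basis k x / (2 * x + \<sigma>)"
    using basis_forward[of x k] assms(1,2) by (simp add: B_def divide_simps mult_ac)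
  have D: "D x * (basis (Suc k) (x - 1) - basis (Suc k) x) =
     - (real k + 1) * (x + \<delta>) * (real N + x + \<sigma>) * (real k - x) * basis k x / (2 * x + \<sigma>)"
  proof (cases "x = 0")
    case True
    then show ?thesis by (cases k) (auto simp: D_def d_def basis_def pochhammer_0_left)
  next
    case False
    then show ?thesis using assms basis_backward[of x k] by (simp add: D_def divide_simps mult_ac)
  qed
  have S: "basis (Suc k) x = (real k - x) * (x + \<sigma> + real k) * basis k x"
    by (simp add: basis_def pochhammer_Suc)
  \<comment> \<open>The identity behind the formula: the factor \<open>2 * x + \<sigma>\<close>
    splits off and cancels the remaining denominator.\<close>
  have key: "(x + \<gamma> + 1) * (real N - x) * (x + \<sigma> + real k) + (x + \<delta>) * (real N + x + \<sigma>) * (real k - x)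
    = (2 * x + \<sigma>) * ((real k - x) * (x + \<sigma> + real k) + (\<gamma> + real k + 1) * (real N - real k))"
    unfolding \<sigma>_def by algebra
  have "L (basis (Suc k)) x = - (real k + 1) * basis k x / (2 * x + \<sigma>) *
     ((x + \<gamma> + 1) * (real N - x) * (x + \<sigma> + real k) + (x + \<delta>) * (real N + x + \<sigma>) * (real k - x))"
    unfolding L_def B D by (simp add: divide_simps assms(1)) algebra
  also have "\<dots> = - (real k + 1) * basis k x *
       ((real k - x) * (x + \<sigma> + real k) + (\<gamma> + real k + 1) * (real N - real k))"
    unfolding key using assms(1) by simp
  finally show ?thesis unfolding S by algebra
qed

lemma L_basis_0: "L (basis 0) x = 0"
  by (simp add: L_def basis_def)

lemma L_sum: "L (\<lambda>x. \<Sum>k\<in>K. c k * f k x) x = (\<Sum>k\<in>K. c k * L (f k) x)"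
  by (simp add: L_def sum_distrib_left sum_subtractf[symmetric] sum.distrib[symmetric] algebra_simps)

definition cf :: "nat \<Rightarrow> real" where
  "cf k = pochhammer (- real n) k / (fact k * pochhammer (\<gamma> + 1) k * pochhammer (- real N) k)"

lemma poly_Y: "poly Y x = (\<Sum>k\<le>n. cf k * basis k x)"
  by (simp add: Y_def poly_dual_hahn_lambda cf_def basis_def \<sigma>_def algebra_simps)

lemma cf_Suc:
  assumes "k < n"
  shows "cf (Suc k) * ((real k + 1) * (\<gamma> + real k + 1) * (real N - real k)) = (real n - real k) * cf k"
proof -
  have "pochhammer (\<gamma> + 1) j \<noteq> 0" for j using pochhammer_pos[of "\<gamma> + 1" j] gam by simp
  moreover have "\<gamma> + 1 + real k \<noteq> 0" using gam by simp
  moreover have "real k - real N \<noteq> 0" using assms nN by simp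
  moreover have "pochhammer (- real N) k \<noteq> 0"
    using assms nN by (auto simp: pochhammer_eq_0_iff)
  ultimately show ?thesis
    by (simp add: cf_def pochhammer_Suc divide_simps) (simp add: algebra_simps)
qed

lemma L_Y:
  assumes "2 * x + \<sigma> \<noteq> 0" "2 * x + \<sigma> + 1 \<noteq> 0" "x = 0 \<or> 2 * x + \<sigma> - 1 \<noteq> 0"
  shows "L (poly Y) x = - real n * poly Y x"
proof -
  obtain m where m: "n = Suc m" using n1 by (cases n) auto
  have "L (poly Y) x = (\<Sum>k\<le>n. cf k * L (basis k) x)"
    using L_sum[of cf basis "{..n}" x] by (simp add: poly_Y[abs_def])
  also have "\<dots> = (\<Sum>k\<le>m. cf (Suc k) * L (basis (Suc k)) x)"
    by (simp only: m sum.atMost_Suc_shift L_basis_0 mult_zero_right add_0)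
  also have "\<dots> = (\<Sum>k\<le>m. - (real (Suc k)) * cf (Suc k) * basis (Suc k) x - (real n - real k) * cf k * basis k x)"
  proof (rule sum.cong)
    fix k assume "k \<in> {..m}"
    then have "k < n" by (simp add: m)
    show "cf (Suc k) * L (basis (Suc k)) x =
        - (real (Suc k)) * cf (Suc k) * basis (Suc k) x - (real n - real k) * cf k * basis k x"
      unfolding L_basis_Suc[OF assms] cf_Suc[OF \<open>k < n\<close>, symmetric] of_nat_Suc by algebra
  qed simp
  \<comment> \<open>Both sums may run over all \<open>k \<le> n\<close>: the first has the factor
    \<open>k\<close>, zero at \<open>k = 0\<close>, the second the factor \<open>n - k\<close>, zero
    at \<open>k = n\<close>. Together they give \<open>- k - (n - k) = - n\<close>.\<close>
  also have "\<dots> = (\<Sum>k\<le>n. - real k * cf k * basis k x) - (\<Sum>k\<le>n. (real n - real k) * cf k * basis k x)"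
  proof -
    have "(\<Sum>k\<le>n. - real k * cf k * basis k x) = (\<Sum>k\<le>m. - (real (Suc k)) * cf (Suc k) * basis (Suc k) x)"
      unfolding m sum.atMost_Suc_shift by simp
    moreover have "(\<Sum>k\<le>n. (real n - real k) * cf k * basis k x) = (\<Sum>k\<le>m. (real n - real k) * cf k * basis k x)"
      unfolding m by simp
    ultimately show ?thesis by (simp add: sum_subtractf)
  qed
  also have "\<dots> = - real n * poly Y x"
    unfolding poly_Y sum_distrib_left sum_subtractf[symmetric] by (rule sum.cong) (auto simp: algebra_simps)
  finally show ?thesis .
qed

section \<open>Orthogonality on the grid\<close>

lemma B_pos: "B x > 0" if "0 \<le> x" "x < real N"
  using that gam sig1 by (auto simp: B_def b_def intro!: divide_pos_pos mult_pos_pos)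

lemma D_pos: "D x > 0" if "0 < x"
  using that del sig1 by (auto simp: D_def d_def intro!: divide_pos_pos mult_pos_pos)

text \<open>The stationary weight of the birth and death chain with rates \<open>B\<close> and
  \<open>D\<close>, built from detailed balance.\<close>

definition wt :: "nat \<Rightarrow> real" where "wt i = (\<Prod>j<i. B (real j) / D (real j + 1))"

lemma wt_pos: "i \<le> N \<Longrightarrow> wt i > 0"
  unfolding wt_def by (intro prod_pos) (auto intro!: divide_pos_pos B_pos D_pos)

lemma wt_Suc: "wt (Suc i) * D (real i + 1) = wt i * B (real i)"
  using D_pos[of "real i + 1"] by (simp add: wt_def)

definition ip :: "(real \<Rightarrow> real) \<Rightarrow> (real \<Rightarrow> real) \<Rightarrow> real" where
  "ip f g = (\<Sum>i\<le>N. wt i * f (real i) * g (real i))"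

text \<open>Summation by parts. The boundary terms drop out because \<open>B\<close> vanishes at
  \<open>N\<close> and \<open>D\<close> at \<open>0\<close>, which removes the values of
  \<open>f\<close> at \<open>N + 1\<close> and \<open>- 1\<close>. The right-hand side is symmetric
  in \<open>f\<close> and \<open>g\<close>.\<close>

lemma ip_L:
  "ip (L f) g =
     - (\<Sum>i<N. wt i * B (real i) * (f (real i + 1) - f (real i)) * (g (real i + 1) - g (real i)))"
proof -
  have "ip (L f) g = (\<Sum>i\<le>N. wt i * B (real i) * (f (real i + 1) - f (real i)) * g (real i))
      + (\<Sum>i\<le>N. wt i * D (real i) * (f (real i - 1) - f (real i)) * g (real i))"
    by (simp add: ip_def L_def algebra_simps sum.distrib[symmetric])
  also have "(\<Sum>i\<le>N. wt i * B (real i) * (f (real i + 1) - f (real i)) * g (real i)) =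
     (\<Sum>i<N. wt i * B (real i) * (f (real i + 1) - f (real i)) * g (real i))"
    by (simp add: lessThan_Suc_atMost[symmetric] B_def b_def)
  also have "(\<Sum>i\<le>N. wt i * D (real i) * (f (real i - 1) - f (real i)) * g (real i)) =
     (\<Sum>i<N. wt i * B (real i) * (f (real i) - f (real i + 1)) * g (real i + 1))"
    by (simp add: sum.atMost_shift D_def[of 0] d_def[of 0] wt_Suc add.commute[of 1] flip: wt_Suc)
  finally show ?thesis
    by (simp add: sum_negf[symmetric] sum.distrib[symmetric] algebra_simps)
qed

lemma ip_sym: "ip f g = ip g f"
  by (simp add: ip_def mult_ac)

lemma ip_L_sym: "ip (L f) g = ip f (L g)"
proof -
  have "ip (L f) g = ip (L g) f" by (simp add: ip_L mult_ac)
  then show ?thesis by (simp add: ip_sym)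
qed

lemma grid_regular:
  "2 * real i + \<sigma> \<noteq> 0" "2 * real i + \<sigma> + 1 \<noteq> 0" "real i = 0 \<or> 2 * real i + \<sigma> - 1 \<noteq> 0"
  using sig1 by (cases i; auto)+

text \<open>\<open>L\<close> has eigenvalue \<open>- n\<close> on \<open>Y\<close> and diagonal
  entry \<open>- m\<close> on \<open>basis m\<close>. Self-adjointness equates the two products up
  to a lower term, which vanishes by induction, and \<open>m \<noteq> n\<close> leaves zero.\<close>

lemma ip_Y_basis: "m < n \<Longrightarrow> ip (poly Y) (basis m) = 0"
proof (induction m)
  case 0
  have "- real n * ip (poly Y) (basis 0) = ip (L (poly Y)) (basis 0)"
    by (simp add: ip_def L_Y[OF grid_regular] sum_distrib_left mult_ac flip: sum_negf)
  also have "\<dots> = 0" by (simp add: ip_L_sym) (simp add: ip_def L_basis_0)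
  finally show ?case using 0 by simp
next
  case (Suc m)
  have "- real n * ip (poly Y) (basis (Suc m)) = ip (L (poly Y)) (basis (Suc m))"
    by (simp add: ip_def L_Y[OF grid_regular] sum_distrib_left mult_ac flip: sum_negf)
  also have "\<dots> = ip (poly Y) (L (basis (Suc m)))" by (rule ip_L_sym)
  also have "\<dots> = - (real m + 1) * ip (poly Y) (basis (Suc m))
      - (real m + 1) * (\<gamma> + real m + 1) * (real N - real m) * ip (poly Y) (basis m)"
    unfolding ip_def L_basis_Suc[OF grid_regular] sum_distrib_left sum_subtractf[symmetric]
    by (rule sum.cong) (auto simp: algebra_simps)
  finally have "(real n - (real m + 1)) * ip (poly Y) (basis (Suc m)) = 0"
    using Suc by (simp add: algebra_simps)
  then show ?case using Suc.prems by auto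
qed

definition basis_poly :: "nat \<Rightarrow> real poly" where
  "basis_poly k = (\<Prod>i<k. [:real i * (real i + \<sigma>), -1:])"

lemma poly_basis_poly: "poly (basis_poly k) (lam x) = basis k x"
proof -
  have "basis k x = poly (pochhammer [:0, -1:] k * pochhammer [:\<sigma>, 1:] k) x"
    by (simp add: basis_def poly_pochhammer add.commute)
  also have "\<dots> = poly (basis_poly k) (lam x)"
    unfolding pochhammer_lambda basis_poly_def[symmetric]
    by (simp add: poly_pcompose lam_def algebra_simps)
  finally show ?thesis by simp
qed

lemma basis_poly: "degree (basis_poly k) = k" "basis_poly k \<noteq> 0"
  by (auto simp: basis_poly_def degree_prod_eq_sum_degree)

lemma ip_Y_poly: "degree q < n \<Longrightarrow> ip (poly Y) (\<lambda>x. poly q (lam x)) = 0"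
proof (induction "degree q" arbitrary: q rule: less_induct)
  case less
  define m where "m = degree q"
  define a where "a = lead_coeff q / lead_coeff (basis_poly m)"
  define r where "r = q - smult a (basis_poly m)"
  have "coeff r m = 0" using basis_poly[of m] leading_coeff_0_iff[of "basis_poly m"] by (auto simp: r_def a_def m_def)
  moreover have "degree r \<le> m"
    unfolding r_def by (rule degree_diff_le) (auto simp: m_def basis_poly intro: order.trans[OF degree_smult_le])
  ultimately have "r = 0 \<or> degree r < m"
    by (metis le_neq_implies_less leading_coeff_0_iff)
  then have r: "ip (poly Y) (\<lambda>x. poly r (lam x)) = 0"
  proof
    assume "r = 0" then show ?thesis by (simp add: ip_def)
  next
    assume "degree r < m" then show ?thesis using less by (simp add: m_def)
  qed
  have q: "poly q (lam x) = poly r (lam x) + a * basis m x" for x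
    by (simp add: r_def poly_basis_poly)
  have "ip (poly Y) (\<lambda>x. poly q (lam x)) = ip (poly Y) (\<lambda>x. poly r (lam x)) + a * ip (poly Y) (basis m)"
    unfolding q by (simp add: ip_def sum_distrib_left sum.distrib[symmetric] algebra_simps)
  then show ?case using r ip_Y_basis[of m] less.prems by (simp add: m_def)
qed

section \<open>The polynomial in the variable \<open>lam x\<close>\<close>

definition R :: "real poly" where
  "R = (SOME R. degree R = n \<and> Y = pcompose R [:0, \<sigma>, 1:])"

lemma R: "degree R = n" "Y = pcompose R [:0, \<sigma>, 1:]"
proof -
  have "\<exists>R. degree R = n \<and> Y = pcompose R [:0, \<sigma>, 1:]"
    unfolding Y_def \<sigma>_def by (rule dual_hahn_lambda_pcompose[OF gam nN])
  from someI_ex[OF this] show "degree R = n" "Y = pcompose R [:0, \<sigma>, 1:]"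
    by (simp_all add: R_def)
qed

lemma R_nonzero: "R \<noteq> 0"
  using R(1) n1 by auto

lemma poly_Y_R: "poly Y x = poly R (lam x)"
  by (simp add: R(2) poly_pcompose lam_def algebra_simps)

lemma lam_less: "0 \<le> x \<Longrightarrow> x < y \<Longrightarrow> lam x < lam y"
  unfolding lam_def using sig1 by (intro mult_strict_mono) auto

lemma lam_le: "0 \<le> x \<Longrightarrow> x \<le> y \<Longrightarrow> lam x \<le> lam y"
  using lam_less[of x y] by (cases "x = y") auto

lemma lam_less_iff: "0 \<le> x \<Longrightarrow> 0 \<le> y \<Longrightarrow> lam x < lam y \<longleftrightarrow> x < y"
  using lam_less[of x y] lam_le[of y x] by linarith

lemma lam_inj: "inj_on lam {0..}"
  by (rule linorder_inj_onI') (use lam_less in force)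

text \<open>Orthogonality to the cofactor \<open>q\<close> makes the sum of \<open>w f q\<^sup>2\<close> over the grid vanish.\<close>

lemma no_signed_factor:
  assumes "R = f * q" "degree f \<ge> 1" and s: "(\<forall>i\<le>N. poly f (lam (real i)) \<ge> 0) \<or> (\<forall>i\<le>N. poly f (lam (real i)) \<le> 0)"
  shows False
proof -
  have "f \<noteq> 0" "q \<noteq> 0" using R_nonzero assms(1) by auto
  then have "degree q < n" using assms(2) R(1) degree_mult_eq[of f q] assms(1) by simp
  then have "ip (poly Y) (\<lambda>x. poly q (lam x)) = 0" by (rule ip_Y_poly)
  then have 0: "(\<Sum>i\<le>N. wt i * poly f (lam (real i)) * (poly q (lam (real i)))\<^sup>2) = 0"
    by (simp add: ip_def poly_Y_R assms(1) power2_eq_square mult_ac)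
  obtain e where e: "e \<noteq> 0" "\<And>i. i \<le> N \<Longrightarrow> 0 \<le> e * poly f (lam (real i))"
    using s by (elim disjE) (auto intro: that[of 1] that[of "- 1"])
  have "(\<Sum>i\<le>N. wt i * (e * poly f (lam (real i))) * (poly q (lam (real i)))\<^sup>2) =
      e * (\<Sum>i\<le>N. wt i * poly f (lam (real i)) * (poly q (lam (real i)))\<^sup>2)"
    by (simp add: sum_distrib_left mult_ac)
  then have "(\<Sum>i\<le>N. wt i * (e * poly f (lam (real i))) * (poly q (lam (real i)))\<^sup>2) = 0"
    using 0 by simp
  then have z: "\<forall>i\<in>{..N}. wt i * (e * poly f (lam (real i))) * (poly q (lam (real i)))\<^sup>2 = 0"
    using wt_pos e(2) by (subst sum_nonneg_eq_0_iff[symmetric]) (simp_all add: less_imp_le)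
  \<comment> \<open>Every grid value is now a root of \<open>f\<close> or of \<open>q\<close>, hence
    of \<open>R\<close>. These are \<open>N + 1\<close> distinct numbers, too many for degree
    \<open>n \<le> N\<close>.\<close>
  have "lam (real i) \<in> {t. poly R t = 0}" if "i \<le> N" for i
    using that bspec[OF z, of i] wt_pos[of i] e(1) by (auto simp: assms(1))
  then have "(\<lambda>i. lam (real i)) ` {..N} \<subseteq> {t. poly R t = 0}" by auto
  then have "card ((\<lambda>i. lam (real i)) ` {..N}) \<le> card {t. poly R t = 0}"
    by (rule card_mono[OF poly_roots_finite[OF R_nonzero]])
  also have "\<dots> \<le> n" using card_poly_roots_bound[OF R_nonzero] R(1) by simp
  finally have "card ((\<lambda>i. lam (real i)) ` {..N}) \<le> n" .
  moreover have "inj_on (\<lambda>i. lam (real i)) {..N}"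
    by (rule inj_onI) (use inj_onD[OF lam_inj] in force)
  ultimately show False using nN by (simp add: card_image)
qed

section \<open>Location of the roots\<close>

lemma R_no_pair:
  assumes "[:- r, 1:] * [:- t, 1:] dvd R" "\<And>i. i \<le> N \<Longrightarrow> 0 \<le> (lam (real i) - r) * (lam (real i) - t)"
  shows False
proof -
  obtain q where "R = ([:- r, 1:] * [:- t, 1:]) * q" using assms(1) by (elim dvdE)
  then show False
    by (rule no_signed_factor) (use assms(2) in \<open>auto simp: algebra_simps\<close>)
qed

lemma R_complex_roots_real:
  assumes "poly (cpoly R) z = 0"
  shows "Im z = 0"
proof (rule ccontr)
  assume "Im z \<noteq> 0"
  from complex_root_quadratic_factor[OF assms this]
  obtain q where "R = [:(cmod z)\<^sup>2, - 2 * Re z, 1:] * q" by (elim dvdE)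
  moreover have "poly [:(cmod z)\<^sup>2, - 2 * Re z, 1:] t = (t - Re z)\<^sup>2 + (Im z)\<^sup>2" for t
    unfolding cmod_power2 by (simp add: power2_eq_square algebra_simps)
  ultimately show False by (elim no_signed_factor) (simp_all del: poly_pCons)
qed

lemma R_root_simple: "\<not> [:- r, 1:] * [:- r, 1:] dvd R"
  using R_no_pair[of r r] by auto

text \<open>A root violating a bound would give a linear factor of constant sign on the
  grid.\<close>

lemma R_root_range:
  assumes "poly R r = 0"
  shows "0 < r" "r < lam (real N)"
proof -
  obtain q where q: "R = [:- r, 1:] * q" using assms by (auto simp: poly_eq_0_iff_dvd elim: dvdE)
  show "0 < r"
  proof (rule ccontr)
    assume "\<not> 0 < r"
    then have "0 \<le> poly [:- r, 1:] (lam (real i))" for i using lam_le[of 0 "real i"] by (simp add: lam_def)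
    then show False by (intro no_signed_factor[OF q]) auto
  qed
  show "r < lam (real N)"
  proof (rule ccontr)
    assume r: "\<not> r < lam (real N)"
    have "poly [:- r, 1:] (lam (real i)) \<le> 0" if "i \<le> N" for i
      using r that lam_le[of "real i" "real N"] by simp
    then show False by (intro no_signed_factor[OF q]) auto
  qed
qed

text \<open>If the linear factors left a nonconstant cofactor, the fundamental theorem of algebra
  would give it a root. That root is real, so it occurs among the linear factors already and would
  be double, against \<open>R_root_simple\<close>.\<close>

lemma R_factorization:
  defines "S \<equiv> {r. poly R r = 0}"
  shows "finite S" "card S = n" "\<exists>c. c \<noteq> 0 \<and> R = smult c (\<Prod>r\<in>S. [:- r, 1:])"
proof -
  show fin: "finite S" unfolding S_def by (rule poly_roots_finite[OF R_nonzero])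
  obtain q where q: "R = (\<Prod>r\<in>S. [:- r, 1:]) * q"
    using linear_factors_dvd[OF fin, of R] by (auto simp: S_def elim: dvdE)
  have "degree q = 0"
  proof (rule ccontr)
    assume "degree q \<noteq> 0"
    then have "\<not> constant (poly (cpoly q))" by (simp add: constant_degree degree_cpoly)
    then obtain z where z: "poly (cpoly q) z = 0" using fundamental_theorem_of_algebra by blast
    then have "poly (cpoly R) z = 0" unfolding q cpoly_mult by simp
    then have "z = complex_of_real (Re z)" using R_complex_roots_real by (simp add: complex_eq_iff)
    then have "poly q (Re z) = 0" using z cpoly_of_real[of q "Re z"] by simp
    then have "[:- Re z, 1:] dvd q" by (simp add: poly_eq_0_iff_dvd)
    moreover have "poly R (Re z) = 0" using \<open>poly q (Re z) = 0\<close> by (subst q) simp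
    then have "[:- Re z, 1:] dvd (\<Prod>r\<in>S. [:- r, 1:])"
      using dvd_prodI[OF fin, of "Re z" "\<lambda>r. [:- r, 1:]"] by (simp add: S_def)
    ultimately have "[:- Re z, 1:] * [:- Re z, 1:] dvd R"
      by (subst q) (rule mult_dvd_mono)
    then show False using R_root_simple by blast
  qed
  then obtain c where c: "q = [:c:]" by (elim degree_eq_zeroE)
  then have R': "R = smult c (\<Prod>r\<in>S. [:- r, 1:])" using q by simp
  then have "c \<noteq> 0" using R_nonzero by auto
  with R' show "\<exists>c. c \<noteq> 0 \<and> R = smult c (\<Prod>r\<in>S. [:- r, 1:])" by blast
  have "degree R = card S" using R' \<open>c \<noteq> 0\<close> by (simp add: degree_prod_eq_sum_degree)
  then show "card S = n" using R(1) by simp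
qed

definition Apos :: "real set" where "Apos = {x. 0 < x \<and> x < real N \<and> poly Y x = 0}"

text \<open>\<open>a\<close> and \<open>mirror a\<close> are the two solutions of
  \<open>lam x = lam a\<close>.\<close>

definition mirror :: "real \<Rightarrow> real" where "mirror x = - x - \<sigma>"

definition Z :: "real set" where "Z = Apos \<union> mirror ` Apos"

lemma Apos_bij: "bij_betw lam Apos {r. poly R r = 0}"
proof (rule bij_betwI')
  fix x y assume "x \<in> Apos" "y \<in> Apos"
  then show "lam x = lam y \<longleftrightarrow> x = y" using lam_inj by (auto simp: Apos_def inj_on_def)
next
  fix x assume "x \<in> Apos" then show "lam x \<in> {r. poly R r = 0}" by (simp add: Apos_def poly_Y_R)
next
  fix r assume "r \<in> {r. poly R r = 0}"
  then have r: "poly R r = 0" "0 < r" "r < lam (real N)" using R_root_range by auto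
  define x where "x = (sqrt (\<sigma>\<^sup>2 + 4 * r) - \<sigma>) / 2"
  have "sqrt (\<sigma>\<^sup>2 + 4 * r) > \<sigma>" using r sig1 by (intro real_less_rsqrt) auto
  then have x0: "0 < x" by (simp add: x_def)
  have "2 * x + \<sigma> = sqrt (\<sigma>\<^sup>2 + 4 * r)" by (simp add: x_def field_simps)
  then have "(2 * x + \<sigma>)\<^sup>2 = \<sigma>\<^sup>2 + 4 * r" using r by simp
  then have "lam x = r" by (simp add: lam_def power2_eq_square algebra_simps)
  moreover from this have "x < real N" using lam_less_iff[of x "real N"] r x0 by auto
  ultimately show "\<exists>x\<in>Apos. r = lam x" using x0 r by (intro bexI[of _ x]) (auto simp: Apos_def poly_Y_R)
qed

lemma Apos_card: "finite Apos" "card Apos = n"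
  using bij_betw_finite[OF Apos_bij] bij_betw_same_card[OF Apos_bij] R_factorization by auto

lemma AposD: "a \<in> Apos \<Longrightarrow> 0 < a \<and> a < real N"
  by (simp add: Apos_def)

lemma mirror_inj: "inj mirror" by (auto simp: mirror_def inj_def)

lemma Z_disjoint: "Apos \<inter> mirror ` Apos = {}"
  using sig1 by (force simp: Apos_def mirror_def)

lemma Z_card: "finite Z" "card Z = 2 * n"
proof -
  show "finite Z" using Apos_card by (simp add: Z_def)
  have "card Z = card Apos + card (mirror ` Apos)"
    unfolding Z_def using Apos_card Z_disjoint by (intro card_Un_disjoint) auto
  then show "card Z = 2 * n"
    using Apos_card card_image[OF inj_on_subset[OF mirror_inj], of Apos] by simp
qed

lemma Y_factorization: "\<exists>c. c \<noteq> 0 \<and> Y = smult c (\<Prod>a\<in>Z. [:- a, 1:])"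
proof -
  obtain c where c: "c \<noteq> 0" "R = smult c (\<Prod>r\<in>{r. poly R r = 0}. [:- r, 1:])"
    using R_factorization(3) by blast
  have "poly Y x = c * (\<Prod>a\<in>Z. x - a)" for x
  proof -
    have "poly Y x = c * (\<Prod>r\<in>{r. poly R r = 0}. lam x - r)"
      by (subst poly_Y_R, subst c(2)) (simp add: poly_prod)
    also have "(\<Prod>r\<in>{r. poly R r = 0}. lam x - r) = (\<Prod>a\<in>Apos. lam x - lam a)"
      by (rule prod.reindex_bij_betw[OF Apos_bij, symmetric])
    also have "(\<Prod>a\<in>Apos. lam x - lam a) = (\<Prod>a\<in>Apos. (x - a) * (x - mirror a))"
      by (rule prod.cong) (auto simp: lam_def mirror_def algebra_simps)
    also have "(\<Prod>a\<in>Apos. (x - a) * (x - mirror a)) = (\<Prod>a\<in>Z. x - a)"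
      unfolding Z_def using Apos_card Z_disjoint
      by (subst prod.union_disjoint) (auto simp: prod.distrib prod.reindex inj_on_subset[OF mirror_inj])
    finally show ?thesis .
  qed
  then have "poly Y = poly (smult c (\<Prod>a\<in>Z. [:- a, 1:]))"
    by (simp add: fun_eq_iff poly_prod)
  then show ?thesis using c(1) poly_eq_poly_eq_iff by blast
qed

lemma poly_Y_eq_0_iff: "poly Y x = 0 \<longleftrightarrow> x \<in> Z"
proof -
  obtain c where "c \<noteq> 0" "Y = smult c (\<Prod>a\<in>Z. [:- a, 1:])" using Y_factorization by blast
  then show ?thesis using Z_card by (auto simp: poly_prod)
qed

text \<open>No grid point lies strictly between \<open>p\<close> and \<open>q\<close>, so the
  product of the differences is nonnegative on the grid. The cell is closed because a root may be a
  grid point, and \<open>m\<close> is an integer so that the cell to the left of \<open>0\<close>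
  needs no separate treatment.\<close>

lemma grid_cell:
  assumes "p \<in> Apos" "q \<in> Apos" "p \<noteq> q" "real_of_int m \<le> p" "real_of_int m \<le> q"
    "p \<le> real_of_int m + 1" "q \<le> real_of_int m + 1"
  shows False
proof (rule R_no_pair)
  have "(\<Prod>r\<in>{lam p, lam q}. [:- r, 1:]) dvd R"
    using assms by (intro linear_factors_dvd) (auto simp: Apos_def poly_Y_R)
  moreover have "lam p \<noteq> lam q" using assms(1-3) lam_inj by (auto simp: Apos_def inj_on_def)
  ultimately show "[:- lam p, 1:] * [:- lam q, 1:] dvd R" by simp
next
  fix i :: nat
  have pq: "0 < p" "0 < q" using assms by (auto simp: Apos_def)
  show "0 \<le> (lam (real i) - lam p) * (lam (real i) - lam q)"
  proof (cases "int i \<le> m")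
    case True
    then have "real i \<le> p" "real i \<le> q" using assms(4,5) by linarith+
    then show ?thesis by (intro mult_nonpos_nonpos) (simp_all add: lam_le)
  next
    case False
    then have "real i \<ge> real_of_int m + 1" by linarith
    then have "real i \<ge> p" "real i \<ge> q" using assms(6,7) by linarith+
    then show ?thesis using pq by (intro mult_nonneg_nonneg) (simp_all add: lam_le)
  qed
qed

section \<open>Separation of the roots\<close>

lemma Z_regular:
  assumes "a \<in> Z"
  shows "2 * a + \<sigma> \<noteq> 0" "2 * a + \<sigma> + 1 \<noteq> 0" "2 * a + \<sigma> - 1 \<noteq> 0"
  using assms sig1 by (auto simp: Z_def Apos_def mirror_def)

lemma BD_mirror: "B (mirror x) = D x" "D (mirror x) = B x"
proof -
  have "d (mirror x) = b x" using reflection(1)[of "mirror x"] by (simp add: mirror_def)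
  moreover have "(2 * mirror x + \<sigma>) * (2 * mirror x + \<sigma> + 1) = (2 * x + \<sigma>) * (2 * x + \<sigma> - 1)"
    "(2 * mirror x + \<sigma>) * (2 * mirror x + \<sigma> - 1) = (2 * x + \<sigma>) * (2 * x + \<sigma> + 1)"
    by (simp_all add: mirror_def algebra_simps)
  moreover have "b (mirror x) = d x" by (simp add: mirror_def reflection)
  ultimately show "B (mirror x) = D x" "D (mirror x) = B x" by (simp_all add: B_def D_def)
qed

lemma BD_pos:
  assumes "a \<in> Z"
  shows "0 < B a \<and> 0 < D a"
proof -
  have "0 < B x \<and> 0 < D x" if "x \<in> Apos" for x
    using AposD[OF that] by (simp add: B_pos D_pos)
  then show ?thesis using assms by (auto simp: Z_def BD_mirror)
qed

lemma root_equation: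
  assumes "a \<in> Z"
  shows "B a * poly Y (a + 1) + D a * poly Y (a - 1) = 0"
proof -
  have "poly Y a = 0" using assms by (simp add: poly_Y_eq_0_iff)
  moreover have "L (poly Y) a = - real n * poly Y a"
    using Z_regular[OF assms] by (intro L_Y) auto
  ultimately show ?thesis by (simp add: L_def)
qed

text \<open>In the rightmost pair \<open>p < q \<le> p + 1\<close>, every other root is farther than 1 from \<open>q\<close>: a second
  one to the left of \<open>q\<close> would share a cell of the integer grid with \<open>p\<close> or \<open>q\<close>. So \<open>Y (q + 1)\<close> and
  \<open>Y (q - 1)\<close> have the same sign, contrary to the difference equation at \<open>q\<close>.\<close>

lemma Apos_separated:
  assumes "x \<in> Apos" "y \<in> Apos" "x < y"
  shows "1 < y - x"
proof (rule ccontr)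
  assume "\<not> 1 < y - x"
  define C where "C = {q \<in> Apos. \<exists>p\<in>Apos. p < q \<and> q - p \<le> 1}"
  define q where "q = Max C"
  have "y \<in> C"
    unfolding C_def using assms \<open>\<not> 1 < y - x\<close> by (auto intro: bexI[of _ x])
  then have C: "finite C" "C \<noteq> {}" using Apos_card(1) by (auto simp: C_def)
  then have "q \<in> C" unfolding q_def by (rule Max_in)
  then obtain p where pq: "p \<in> Apos" "q \<in> Apos" "p < q" "q - p \<le> 1" by (auto simp: C_def)
  have right: "1 < r - q" if "r \<in> Apos" "q < r" for r
  proof (rule ccontr)
    assume "\<not> 1 < r - q"
    then have "r \<in> C" using that pq by (auto simp: C_def not_less)
    then have "r \<le> q" unfolding q_def using C by simp
    then show False using that by simp
  qed
  have qZ: "q \<in> Z" and q0: "0 < q" using pq by (auto simp: Z_def Apos_def)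
  have J: "1 < q - c" if "c \<in> mirror ` Apos" for c
    using that q0 sig1 by (auto simp: mirror_def Apos_def)
  \<comment> \<open>Excludes a distance of exactly 1: by the difference equation a root at
    \<open>q - 1\<close> would force one at \<open>q + 1\<close>, against
    \<open>right\<close>.\<close>
  have "q + 1 \<notin> Z"
    using right[of "q + 1"] J[of "q + 1"] by (auto simp: Z_def)
  then have "poly Y (q + 1) \<noteq> 0" by (simp add: poly_Y_eq_0_iff)
  then have "poly Y (q - 1) \<noteq> 0"
    using root_equation[OF qZ] BD_pos[OF qZ] by auto
  then have "p \<noteq> q - 1" using pq by (auto simp: poly_Y_eq_0_iff Z_def)
  then have qp: "q - p < 1" using pq by linarith
  have left: "1 < q - r" if r: "r \<in> Apos" "r < q" "r \<noteq> p" for r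
  proof (rule ccontr)
    assume "\<not> 1 < q - r"
    moreover have "r \<noteq> q - 1" using r \<open>poly Y (q - 1) \<noteq> 0\<close> by (auto simp: poly_Y_eq_0_iff Z_def)
    ultimately have rq: "q - r < 1" by linarith
    define m where "m = \<lfloor>q\<rfloor>"
    have m: "real_of_int m \<le> q" "q < real_of_int m + 1" by (auto simp: m_def)
    \<comment> \<open>Neither \<open>p\<close> nor \<open>r\<close> shares the cell of
      \<open>q\<close>, so both would lie in the next cell to the left.\<close>
    have "p < real_of_int m"
    proof (rule ccontr)
      assume "\<not> p < real_of_int m"
      then show False using pq m by (intro grid_cell[of p q m]) auto
    qed
    moreover have "r < real_of_int m"
    proof (rule ccontr)
      assume "\<not> r < real_of_int m"
      then show False using r pq m by (intro grid_cell[of r q m]) auto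
    qed
    ultimately show False
      using pq r m qp rq by (intro grid_cell[of p r "m - 1"]) auto
  qed
  obtain c where c: "c \<noteq> 0" "Y = smult c (\<Prod>a\<in>Z. [:- a, 1:])" using Y_factorization by blast
  then have Y_prod: "poly Y x = c * (\<Prod>a\<in>Z. x - a)" for x by (simp add: poly_prod)
  have "poly Y (q + 1) * poly Y (q - 1) = c\<^sup>2 * ((\<Prod>a\<in>Z. q + 1 - a) * (\<Prod>a\<in>Z. q - 1 - a))"
    by (simp add: Y_prod power2_eq_square)
  \<comment> \<open>A factor of the paired product is negative exactly when \<open>a\<close> is
    within distance 1 of \<open>q\<close>. This happens for \<open>a = q\<close> and
    \<open>a = p\<close> only, so the product is positive.\<close>
  also have "(\<Prod>a\<in>Z. q + 1 - a) * (\<Prod>a\<in>Z. q - 1 - a) = (\<Prod>a\<in>Z. (q - a)\<^sup>2 - 1)"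
    unfolding prod.distrib[symmetric] by (rule prod.cong) (auto simp: power2_eq_square algebra_simps)
  also have "\<dots> = ((q - q)\<^sup>2 - 1) * (\<Prod>a\<in>Z - {q}. (q - a)\<^sup>2 - 1)"
    by (rule prod.remove[OF Z_card(1) qZ])
  also have "(\<Prod>a\<in>Z - {q}. (q - a)\<^sup>2 - 1) = ((q - p)\<^sup>2 - 1) * (\<Prod>a\<in>Z - {q} - {p}. (q - a)\<^sup>2 - 1)"
    using Z_card(1) pq by (intro prod.remove) (auto simp: Z_def)
  finally have eq: "poly Y (q + 1) * poly Y (q - 1) =
      - (c\<^sup>2 * (((q - p)\<^sup>2 - 1) * (\<Prod>a\<in>Z - {q} - {p}. (q - a)\<^sup>2 - 1)))" by simp
  have "(q - a)\<^sup>2 - 1 > 0" if "a \<in> Z - {q} - {p}" for a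
  proof -
    have "1 < \<bar>q - a\<bar>" 
    proof (cases "a \<in> Apos")
      case True
      then show ?thesis using that left[of a] right[of a] by (cases a q rule: linorder_cases) auto
    next
      case False
      then have "a \<in> mirror ` Apos" using that by (simp add: Z_def)
      then show ?thesis using J[of a] by linarith
    qed
    then have "1 < \<bar>q - a\<bar>\<^sup>2" by (rule one_less_power) simp
    then show ?thesis by simp
  qed
  then have "(\<Prod>a\<in>Z - {q} - {p}. (q - a)\<^sup>2 - 1) > 0" by (rule prod_pos)
  moreover have "(q - p)\<^sup>2 < 1" using pq qp by (intro power_less_one_iff[THEN iffD2]) auto
  ultimately have "((q - p)\<^sup>2 - 1) * (\<Prod>a\<in>Z - {q} - {p}. (q - a)\<^sup>2 - 1) < 0"
    by (intro mult_neg_pos) simp_all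
  then have pos: "poly Y (q + 1) * poly Y (q - 1) > 0"
    unfolding eq using c(1) by (simp add: mult_pos_neg)
  have "B q * (poly Y (q + 1) * poly Y (q + 1)) = - D q * (poly Y (q + 1) * poly Y (q - 1))"
    using root_equation[OF qZ] by algebra
  moreover have "B q * (poly Y (q + 1) * poly Y (q + 1)) \<ge> 0" using BD_pos[OF qZ] by simp
  moreover have "- D q * (poly Y (q + 1) * poly Y (q - 1)) < 0" using BD_pos[OF qZ] pos by simp
  ultimately show False by linarith
qed

lemma Z_separated:
  assumes "x \<in> Z" "y \<in> Z" "x \<noteq> y"
  shows "1 < \<bar>x - y\<bar>"
proof -
  have *: "1 < \<bar>x - y\<bar>" if "x \<in> Apos" "y \<in> Apos" "x \<noteq> y" for x y
    using Apos_separated[of x y] Apos_separated[of y x] that by (cases x y rule: linorder_cases) auto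
  have **: "1 < x - mirror y" if "x \<in> Apos" "y \<in> Apos" for x y
    using that sig1 by (auto simp: Apos_def mirror_def)
  have "x \<in> Apos \<or> (\<exists>x'\<in>Apos. x = mirror x')" "y \<in> Apos \<or> (\<exists>y'\<in>Apos. y = mirror y')"
    using assms by (auto simp: Z_def)
  then show ?thesis
  proof (elim disjE bexE)
    fix x' y' assume "x' \<in> Apos" "x = mirror x'" "y' \<in> Apos" "y = mirror y'"
    then show ?thesis using *[of y' x'] assms(3) by (auto simp: mirror_def)
  qed (use assms(3) *[of x y] **[of x] **[of y] in force)+
qed

section \<open>The force\<close>

abbreviation F :: "real \<Rightarrow> real" where "F \<equiv> dual_hahn_force \<gamma> \<delta> N"

text \<open>The origin of the field: dividing \<open>B\<close> by \<open>D\<close> cancels the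
  common factor \<open>2 * x + \<sigma>\<close>, and the two denominators left over are the factors
  in \<open>2 * x\<close> of the given force.\<close>

lemma force_eq:
  assumes "2 * x + \<sigma> \<noteq> 0" "2 * x + \<sigma> + 1 \<noteq> 0" "2 * x + \<sigma> - 1 \<noteq> 0"
  shows "F x = 1 / 2 * ln (B x / D x)"
proof -
  have "B x / D x = (b x * (2 * x + \<sigma> - 1)) / (d x * (2 * x + \<sigma> + 1))"
    using assms by (cases "d x = 0") (simp_all add: B_def D_def divide_simps)
  also have "b x * (2 * x + \<sigma> - 1) = (x + \<gamma> + 1) * (x + \<gamma> + \<delta> + 1) * (real N - x) * (2 * x + \<gamma> + \<delta>)"
    by (simp add: b_def \<sigma>_def add.assoc)
  also have "d x * (2 * x + \<sigma> + 1) = x * (x + \<gamma> + \<delta> + real N + 1) * (x + \<delta>) * (2 * x + \<gamma> + \<delta> + 2)"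
    unfolding d_def \<sigma>_def by algebra
  finally show ?thesis by (simp add: dual_hahn_force_def)
qed

lemma force_mirror:
  assumes "0 < x"
  shows "F (mirror x) = - F x"
proof -
  have "F (mirror x) = 1 / 2 * ln (D x / B x)"
    using assms sig1 by (subst force_eq) (auto simp: BD_mirror, auto simp: mirror_def)
  moreover have "D x / B x = inverse (B x / D x)" by simp
  moreover have "F x = 1 / 2 * ln (B x / D x)" using assms sig1 by (intro force_eq) auto
  ultimately show ?thesis by (simp only: ln_inverse)
qed

text \<open>The logarithm of \<open>root_equation\<close>. In the values of \<open>Y\<close> at
  \<open>a + 1\<close> and \<open>a - 1\<close> the factor of \<open>a\<close> itself contributes
  \<open>1\<close> and \<open>- 1\<close>; this sign turns the vanishing sum into an equality of two
  products.\<close>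

lemma force_critical:
  assumes "a \<in> Z"
  shows "(\<Sum>c\<in>Z - {a}. pair_force (a - c)) = - F a"
proof -
  obtain k where k: "k \<noteq> 0" "Y = smult k (\<Prod>c\<in>Z. [:- c, 1:])" using Y_factorization by blast
  have 1: "poly Y (a + 1) = k * (\<Prod>c\<in>Z - {a}. a - c + 1)"
    using Z_card(1) assms by (simp add: k(2) poly_prod prod.remove algebra_simps)
  have 2: "poly Y (a - 1) = - k * (\<Prod>c\<in>Z - {a}. a - c - 1)"
    using Z_card(1) assms by (simp add: k(2) poly_prod prod.remove algebra_simps)
  have sep: "1 < \<bar>a - c\<bar>" if "c \<in> Z - {a}" for c using that assms Z_separated[of a c] by auto
  have "a - c - 1 \<noteq> 0" if "c \<in> Z - {a}" for c using sep[OF that] by linarith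
  then have nz: "(\<Prod>c\<in>Z - {a}. a - c - 1) \<noteq> 0" using Z_card(1) by simp
  have "k * (B a * (\<Prod>c\<in>Z - {a}. a - c + 1)) = k * (D a * (\<Prod>c\<in>Z - {a}. a - c - 1))"
    using root_equation[OF assms] unfolding 1 2 by (simp add: algebra_simps)
  then have "B a * (\<Prod>c\<in>Z - {a}. a - c + 1) = D a * (\<Prod>c\<in>Z - {a}. a - c - 1)" using k(1) by simp
  then have "(\<Prod>c\<in>Z - {a}. (a - c + 1) / (a - c - 1)) = inverse (B a / D a)"
    using nz BD_pos[OF assms] by (simp add: prod_dividef field_simps)
  moreover have "ln (\<Prod>c\<in>Z - {a}. (a - c + 1) / (a - c - 1)) =
      (\<Sum>c\<in>Z - {a}. ln ((a - c + 1) / (a - c - 1)))"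
  proof (rule ln_prod)
    fix c assume "c \<in> Z - {a}"
    then have "a - c + 1 \<noteq> 0" "a - c - 1 \<noteq> 0" using sep[of c] by linarith+
    then show "(a - c + 1) / (a - c - 1) \<noteq> 0" by simp
  qed (use Z_card(1) in simp)
  ultimately have "(\<Sum>c\<in>Z - {a}. ln ((a - c + 1) / (a - c - 1))) = - ln (B a / D a)"
    by (simp only: ln_inverse)
  moreover have "(\<Sum>c\<in>Z - {a}. pair_force (a - c)) = 1 / 2 * (\<Sum>c\<in>Z - {a}. ln ((a - c + 1) / (a - c - 1)))"
    by (simp add: pair_force_def sum_distrib_left)
  ultimately show ?thesis using force_eq[OF Z_regular[OF assms]] by simp
qed

lemma force_decreasing_pos:
  assumes "0 < x" "x < y" "y < real N"
  shows "F y < F x"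
proof (rule DERIV_neg_imp_decreasing[OF assms(2)])
  fix t assume "x \<le> t" "t \<le> y"
  then have t: "0 < t" "t < real N" using assms by auto
  define f where "f t = 1 / 2 * (ln (t + \<gamma> + 1) + ln (t + \<gamma> + \<delta> + 1) + ln (real N - t) + ln (2 * t + \<gamma> + \<delta>)
     - ln t - ln (t + \<gamma> + \<delta> + real N + 1) - ln (t + \<delta>) - ln (2 * t + \<gamma> + \<delta> + 2))" for t
  define g where "g = 1 / 2 * (1 / (t + \<gamma> + 1) + 1 / (t + \<gamma> + \<delta> + 1) - 1 / (real N - t) + 2 / (2 * t + \<gamma> + \<delta>)
     - 1 / t - 1 / (t + \<gamma> + \<delta> + real N + 1) - 1 / (t + \<delta>) - 2 / (2 * t + \<gamma> + \<delta> + 2))"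
  have F_f: "f s = F s" if "s \<in> {0<..<real N}" for s
    using that gam del unfolding f_def dual_hahn_force_def by (simp add: ln_mult ln_div)
  have "(f has_real_derivative g) (at t)"
    unfolding f_def g_def using t gam del by (auto intro!: derivative_eq_intros)
  then have "(F has_real_derivative g) (at t)"
    by (rule has_field_derivative_transform_within_open[where S = "{0<..<real N}"])
      (use t F_f in simp_all)
  moreover have "g < 0"
  proof -
    \<comment> \<open>With \<open>h = (\<gamma> + \<delta>) / 2\<close>, the difference
      \<open>1 / (t + h) - 1 / (t + h + 1)\<close> is largest at \<open>h = 0\<close>, where it
      equals \<open>1 / t - 1 / (t + 1)\<close>. The negative pair
      \<open>1 / (t + \<gamma> + 1) - 1 / t\<close> compensates that because
      \<open>\<gamma> \<ge> 0\<close>.\<close>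
    have "1 / (t + \<gamma> + 1) - 1 / t + (2 / (2 * t + \<gamma> + \<delta>) - 2 / (2 * t + \<gamma> + \<delta> + 2)) \<le> 0"
    proof -
      define h where "h = (\<gamma> + \<delta>) / 2"
      have h: "0 \<le> h" using gam del by (simp add: h_def)
      have half: "2 / u = 1 / v" if "u = 2 * v" for u v :: real using that by simp
      have "2 / (2 * t + \<gamma> + \<delta>) = 1 / (t + h)" "2 / (2 * t + \<gamma> + \<delta> + 2) = 1 / (t + h + 1)"
        by (rule half; simp add: h_def field_simps)+
      then have "2 / (2 * t + \<gamma> + \<delta>) - 2 / (2 * t + \<gamma> + \<delta> + 2) = 1 / (t + h) - 1 / (t + h + 1)"
        by simp
      also have "\<dots> = 1 / ((t + h) * (t + h + 1))"
        using t h by (subst diff_frac_eq) auto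
      also have "\<dots> \<le> 1 / (t * (t + 1))"
        using t h by (intro divide_left_mono mult_mono mult_pos_pos) auto
      also have "\<dots> = 1 / t - 1 / (t + 1)"
        using t by (subst diff_frac_eq) auto
      also have "\<dots> \<le> 1 / t - 1 / (t + \<gamma> + 1)"
        using t gam by (intro diff_left_mono divide_left_mono) auto
      finally show ?thesis by simp
    qed
    moreover have "1 / (t + \<gamma> + \<delta> + 1) < 1 / (t + \<delta>)"
      using t gam del by (intro divide_strict_left_mono) auto
    moreover have "0 < 1 / (real N - t)" "0 < 1 / (t + \<gamma> + \<delta> + real N + 1)"
      using t gam del by auto
    moreover have "1 / 2 * (u1 + u2 - u3 + u4 - u5 - u6 - u7 - u8) < 0"
      if "u1 - u5 + (u4 - u8) \<le> 0" "u2 < u7" "0 < u3" "0 < u6" for u1 u2 u3 u4 u5 u6 u7 u8 :: real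
    proof -
      have "u1 + u2 - u3 + u4 - u5 - u6 - u7 - u8 < 0" using that by linarith
      then show ?thesis by simp
    qed
    ultimately show ?thesis unfolding g_def by blast
  qed
  ultimately show "\<exists>g. (F has_real_derivative g) (at t) \<and> g < 0" by blast
qed

section \<open>Configurations on the two intervals and the equilibrium\<close>

abbreviation I :: "real set" where "I \<equiv> {0<..<real N}"

abbreviation J :: "real set" where "J \<equiv> {- real N - \<gamma> - \<delta> - 1<..<- \<gamma> - \<delta> - 1}"

lemma mirror_J: "x \<in> J \<longleftrightarrow> mirror x \<in> I" "mirror x \<in> J \<longleftrightarrow> x \<in> I" "mirror (mirror x) = x"
  by (auto simp: mirror_def \<sigma>_def)

lemma force_decreasing:
  assumes "x \<in> I \<and> y \<in> I \<or> x \<in> J \<and> y \<in> J" "x < y"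
  shows "F y < F x"
  using assms(1)
proof
  assume "x \<in> J \<and> y \<in> J"
  then have "mirror x \<in> I" "mirror y \<in> I" by (simp_all only: mirror_J)
  moreover have "mirror y < mirror x" using assms(2) by (simp add: mirror_def)
  ultimately have "F (mirror x) < F (mirror y)" by (intro force_decreasing_pos) auto
  moreover have "F x = - F (mirror x)" "F y = - F (mirror y)"
    using force_mirror[of "mirror x"] force_mirror[of "mirror y"] \<open>mirror x \<in> I\<close> \<open>mirror y \<in> I\<close>
    by (simp_all add: mirror_J)
  ultimately show ?thesis by simp
qed (use assms(2) in \<open>auto intro: force_decreasing_pos\<close>)

lemma field_tangent:
  assumes \<phi>: "dual_hahn_field \<gamma> \<delta> N \<phi>" and "x \<in> I \<and> y \<in> I \<or> x \<in> J \<and> y \<in> J" "x \<noteq> y"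
  shows "\<phi> x - F x * (y - x) < \<phi> y"
proof -
  have "\<phi> x + - F x * (y - x) < \<phi> y"
    using assms(2)
  proof
    assume "x \<in> I \<and> y \<in> I"
    then show ?thesis
      using \<phi> assms(3) force_decreasing
      by (intro strict_tangent[of I]) (auto simp: dual_hahn_field_def is_interval_oo)
  next
    assume "x \<in> J \<and> y \<in> J"
    then show ?thesis
      using \<phi> assms(3) force_decreasing
      by (intro strict_tangent[of J]) (auto simp: dual_hahn_field_def is_interval_oo)
  qed
  then show ?thesis by simp
qed

lemma Z_parts: "Z \<inter> I = Apos" "Z \<inter> J = mirror ` Apos" "Z \<subseteq> I \<union> J"
proof -
  have "x \<in> I" if "x \<in> Apos" for x using that by (simp add: Apos_def)
  moreover have "x \<in> J" if "x \<in> mirror ` Apos" for x using that calculation mirror_J(2) by auto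
  moreover have "I \<inter> J = {}" using sig1 by (auto simp: \<sigma>_def)
  ultimately show "Z \<inter> I = Apos" "Z \<inter> J = mirror ` Apos" "Z \<subseteq> I \<union> J"
    unfolding Z_def by blast+
qed

text \<open>The gap between the open intervals has length \<open>\<sigma> \<ge> 1\<close>. Points of
  different intervals are thus ordered in the same way in every admissible configuration.\<close>

lemma I_J_separated: "x \<in> I \<Longrightarrow> y \<in> J \<Longrightarrow> 1 < x - y"
  using gam del by auto

definition arrangement :: "(nat \<Rightarrow> real) \<Rightarrow> bool" where
  "arrangement x \<longleftrightarrow> bij_betw x {1..n} (Z \<inter> I) \<and> bij_betw x {n+1..2*n} (Z \<inter> J)"

lemma arrangement_bij:
  assumes "arrangement x"
  shows "bij_betw x {1..2*n} Z"
proof -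
  have "bij_betw x ({1..n} \<union> {n+1..2*n}) (Z \<inter> I \<union> Z \<inter> J)"
    using assms Z_disjoint unfolding arrangement_def Z_parts by (intro bij_betw_combine) auto
  moreover have "{1..n} \<union> {n+1..2*n} = {1..2*n}" by auto
  moreover have "Z \<inter> I \<union> Z \<inter> J = Z" using Z_parts(3) by blast
  ultimately show ?thesis by simp
qed

abbreviation adm :: "(nat \<Rightarrow> real) \<Rightarrow> bool" where
  "adm \<equiv> admissible n 0 (real N) (- real N - \<gamma> - \<delta> - 1) (- \<gamma> - \<delta> - 1)"

lemma admD:
  assumes "adm y"
  shows "j \<in> {1..n} \<Longrightarrow> y j \<in> I" "j \<in> {n+1..2*n} \<Longrightarrow> y j \<in> J"
    "j \<in> {1..2*n} \<Longrightarrow> k \<in> {1..2*n} \<Longrightarrow> j \<noteq> k \<Longrightarrow> 1 < \<bar>y j - y k\<bar>"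
  using assms unfolding admissible_def by blast+

lemma arrangement_admissible:
  assumes "arrangement x"
  shows "adm x"
  unfolding admissible_def
proof (intro conjI ballI impI)
  fix j assume "j \<in> {1..n}" then show "x j \<in> I"
    using assms bij_betwE unfolding arrangement_def by blast
next
  fix j assume "j \<in> {n+1..2*n}" then show "x j \<in> J"
    using assms bij_betwE unfolding arrangement_def by blast
next
  fix j k assume jk: "j \<in> {1..2*n}" "k \<in> {1..2*n}" "j \<noteq> k"
  then have "x j \<in> Z" "x k \<in> Z" using arrangement_bij[OF assms] bij_betwE by blast+
  moreover have "x j \<noteq> x k"
    using jk arrangement_bij[OF assms] by (auto simp: bij_betw_def dest: inj_onD)
  ultimately show "1 < \<bar>x j - x k\<bar>" by (rule Z_separated)
qed

lemma admissible_matching: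
  assumes "adm y"
  shows "\<exists>z. arrangement z \<and> (\<forall>j\<in>{1..2*n}. \<forall>k\<in>{1..2*n}. z j < z k \<longleftrightarrow> y j < y k)"
proof -
  have sep: "1 < \<bar>y j - y k\<bar>" if "j \<in> {1..2*n}" "k \<in> {1..2*n}" "j \<noteq> k" for j k
    using admD(3)[OF assms that] .
  have "inj_on y {1..2*n}"
    by (rule inj_onI) (use sep in force)
  then have inj: "inj_on y {1..n}" "inj_on y {n+1..2*n}" by (auto elim: inj_on_subset)
  have cards: "finite (Z \<inter> I)" "card (Z \<inter> I) = card {1..n}" "finite (Z \<inter> J)" "card (Z \<inter> J) = card {n+1..2*n}"
    unfolding Z_parts using Apos_card card_image[OF inj_on_subset[OF mirror_inj], of Apos] by auto
  obtain u where u: "bij_betw u {1..n} (Z \<inter> I)" "\<forall>j\<in>{1..n}. \<forall>k\<in>{1..n}. u j < u k \<longleftrightarrow> y j < y k"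
    using order_matching[OF _ inj(1) cards(1,2)] by auto
  obtain v where v: "bij_betw v {n+1..2*n} (Z \<inter> J)"
      "\<forall>j\<in>{n+1..2*n}. \<forall>k\<in>{n+1..2*n}. v j < v k \<longleftrightarrow> y j < y k"
    using order_matching[OF _ inj(2) cards(3,4)] by auto
  define z where "z j = (if j \<le> n then u j else v j)" for j
  have "bij_betw z {1..n} (Z \<inter> I) = bij_betw u {1..n} (Z \<inter> I)"
    by (rule bij_betw_cong) (simp add: z_def)
  moreover have "bij_betw z {n+1..2*n} (Z \<inter> J) = bij_betw v {n+1..2*n} (Z \<inter> J)"
    by (rule bij_betw_cong) (simp add: z_def)
  ultimately have arr: "arrangement z" using u v by (simp add: arrangement_def)
  have zI: "z j \<in> I" "y j \<in> I" if "j \<in> {1..n}" for j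
    using that by (rule admD(1)[OF arrangement_admissible[OF arr]], rule admD(1)[OF assms])
  have zJ: "z j \<in> J" "y j \<in> J" if "j \<in> {n+1..2*n}" for j
    using that by (rule admD(2)[OF arrangement_admissible[OF arr]], rule admD(2)[OF assms])
  have "z j < z k \<longleftrightarrow> y j < y k" if "j \<in> {1..2*n}" "k \<in> {1..2*n}" for j k
  proof -
    have "j \<in> {1..n} \<or> j \<in> {n+1..2*n}" "k \<in> {1..n} \<or> k \<in> {n+1..2*n}" using that by auto
    then consider "j \<in> {1..n}" "k \<in> {1..n}" | "j \<in> {1..n}" "k \<in> {n+1..2*n}"
      | "j \<in> {n+1..2*n}" "k \<in> {1..n}" | "j \<in> {n+1..2*n}" "k \<in> {n+1..2*n}" by blast
    then show ?thesis
    proof cases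
      case 1 then show ?thesis using u(2) by (simp add: z_def)
    next
      case 2 then show ?thesis
        using I_J_separated[OF zI(1) zJ(1), of j k] I_J_separated[OF zI(2) zJ(2), of j k] by simp
    next
      case 3 then show ?thesis
        using I_J_separated[OF zI(1) zJ(1), of k j] I_J_separated[OF zI(2) zJ(2), of k j] by simp
    next
      case 4 then show ?thesis using v(2) by (simp add: z_def)
    qed
  qed
  with arr show ?thesis by blast
qed

lemma arrangement_energy_less:
  assumes \<phi>: "dual_hahn_field \<gamma> \<delta> N \<phi>" and y: "adm y" and z: "arrangement z"
    and ord: "\<forall>j\<in>{1..2*n}. \<forall>k\<in>{1..2*n}. z j < z k \<longleftrightarrow> y j < y k"
    and ne: "j0 \<in> {1..2*n}" "y j0 \<noteq> z j0"
  shows "energy \<phi> (2 * n) z < energy \<phi> (2 * n) y"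
proof (rule critical_energy_less[where F = F])
  note za = arrangement_admissible[OF z]
  fix j assume j: "j \<in> {1..2*n}"
  have "j \<in> {1..n} \<or> j \<in> {n+1..2*n}" using j by auto
  then have "z j \<in> I \<and> y j \<in> I \<or> z j \<in> J \<and> y j \<in> J"
    using admD(1,2)[OF za] admD(1,2)[OF y] by blast
  then show "\<phi> (z j) - F (z j) * (y j - z j) < \<phi> (y j)" if "y j \<noteq> z j"
    using that by (intro field_tangent[OF \<phi>]) auto
  have bij: "bij_betw z {1..2*n} Z" by (rule arrangement_bij[OF z])
  have "bij_betw z ({1..2*n} - {j}) (Z - {z j})"
    using j bij inj_on_image_set_diff[of z "{1..2*n}" "{1..2*n}" "{j}"]
    by (auto simp: bij_betw_def inj_on_diff)
  then have "(\<Sum>k\<in>{1..2*n} - {j}. pair_force (z j - z k)) = (\<Sum>c\<in>Z - {z j}. pair_force (z j - c))"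
    by (rule sum.reindex_bij_betw)
  also have "\<dots> = - F (z j)" using bij j by (intro force_critical) (auto simp: bij_betw_def)
  finally show "(\<Sum>k\<in>{1..2*n} - {j}. pair_force (z j - z k)) = - F (z j)" .
  show "z j < z k \<longleftrightarrow> y j < y k" if "k \<in> {1..2*n}" for k using ord j that by blast
  show "1 < \<bar>z j - z k\<bar> \<and> 1 < \<bar>y j - y k\<bar>" if "k \<in> {1..2*n}" "j \<noteq> k" for k
    using admD(3)[OF za j that] admD(3)[OF y j that] by blast
qed (use ne in auto)

text \<open>The critical point itself is the minimizer, so existence takes no compactness argument.
  A competitor is compared with the arrangement that is ordered like it, and all arrangements have
  the same energy by \<open>energy_reindex\<close>.\<close>

lemma equilibrium_iff_arrangement:
  assumes \<phi>: "dual_hahn_field \<gamma> \<delta> N \<phi>"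
  shows "equilibrium_distribution \<phi> n 0 (real N) (- real N - \<gamma> - \<delta> - 1) (- \<gamma> - \<delta> - 1) x \<longleftrightarrow> arrangement x"
proof
  assume "equilibrium_distribution \<phi> n 0 (real N) (- real N - \<gamma> - \<delta> - 1) (- \<gamma> - \<delta> - 1) x"
  then have x: "adm x" "\<And>y. adm y \<Longrightarrow> energy \<phi> (2 * n) x \<le> energy \<phi> (2 * n) y"
    by (auto simp: equilibrium_distribution_def)
  obtain z where z: "arrangement z" "\<forall>j\<in>{1..2*n}. \<forall>k\<in>{1..2*n}. z j < z k \<longleftrightarrow> x j < x k"
    using admissible_matching[OF x(1)] by blast
  have eq: "x j = z j" if "j \<in> {1..2*n}" for j
    using arrangement_energy_less[OF \<phi> x(1) z that] x(2)[OF arrangement_admissible[OF z(1)]] by linarith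
  have "bij_betw x {1..n} (Z \<inter> I) = bij_betw z {1..n} (Z \<inter> I)"
    by (rule bij_betw_cong) (auto intro: eq)
  moreover have "bij_betw x {n+1..2*n} (Z \<inter> J) = bij_betw z {n+1..2*n} (Z \<inter> J)"
    by (rule bij_betw_cong) (auto intro: eq)
  ultimately show "arrangement x" using z(1) by (simp add: arrangement_def)
next
  assume x: "arrangement x"
  have "energy \<phi> (2 * n) x \<le> energy \<phi> (2 * n) y" if y: "adm y" for y
  proof -
    obtain z where z: "arrangement z" "\<forall>j\<in>{1..2*n}. \<forall>k\<in>{1..2*n}. z j < z k \<longleftrightarrow> y j < y k"
      using admissible_matching[OF y] by blast
    have "energy \<phi> (2 * n) x = energy \<phi> (2 * n) z"
      by (simp only: energy_reindex[OF arrangement_bij[OF x]] energy_reindex[OF arrangement_bij[OF z(1)]])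
    also have "\<dots> \<le> energy \<phi> (2 * n) y"
    proof (cases "\<exists>j\<in>{1..2*n}. y j \<noteq> z j")
      case True
      then show ?thesis using arrangement_energy_less[OF \<phi> y z] by (auto intro: less_imp_le)
    next
      case False
      then have "energy \<phi> (2 * n) z = energy \<phi> (2 * n) y" by (simp add: energy_def)
      then show ?thesis by simp
    qed
    finally show ?thesis .
  qed
  then show "equilibrium_distribution \<phi> n 0 (real N) (- real N - \<gamma> - \<delta> - 1) (- \<gamma> - \<delta> - 1) x"
    using arrangement_admissible[OF x] by (simp add: equilibrium_distribution_def)
qed

end

section \<open>Monotonicity in \<open>N\<close>\<close>

lemma pair_force_antimono: "1 < u \<Longrightarrow> u \<le> v \<Longrightarrow> pair_force v \<le> pair_force u"
  using pair_force_decreasing[of u v] by (cases "u = v") auto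

text \<open>With \<open>\<lambda>(x) = x (x + s)\<close>, the forces exerted on \<open>a\<close> by \<open>c\<close> and by its mirror image \<open>- c - s\<close> add up
  to half the logarithm of \<open>(\<lambda>(a + 1) - \<lambda>(c)) / (\<lambda>(a - 1) - \<lambda>(c))\<close>, which increases with \<open>c\<close>.\<close>

lemma mirrored_pair_force_mono:
  fixes a c c' s :: real
  assumes "0 < a" "0 < c" "c \<le> c'" "1 \<le> s" "c' < a - 1 \<or> a + 1 < c"
  shows "pair_force (a - c) + pair_force (a + c + s) \<le> pair_force (a - c') + pair_force (a + c' + s)"
proof -
  define l where "l x = x * (x + s)" for x :: real
  have ln: "pair_force (a - c) + pair_force (a + c + s) = 1 / 2 * ln ((l (a + 1) - l c) / (l (a - 1) - l c))"
    and pos: "0 < (l (a + 1) - l c) / (l (a - 1) - l c)"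
    and neg: "l (a - 1) - l c < 0 \<longleftrightarrow> a + 1 < c" and nz: "l (a - 1) - l c \<noteq> 0"
    if "0 < c" "c < a - 1 \<or> a + 1 < c" for c
  proof -
    have "(l (a + 1) - l c) / (l (a - 1) - l c) = ((a - c + 1) / (a - c - 1)) * ((a + c + s + 1) / (a + c + s - 1))"
      by (simp add: l_def) (simp add: algebra_simps)
    moreover have p1: "0 < (a - c + 1) / (a - c - 1)"
      using that by (auto simp: zero_less_divide_iff)
    moreover have p2: "0 < (a + c + s + 1) / (a + c + s - 1)"
      using that assms by (intro divide_pos_pos) auto
    ultimately show "pair_force (a - c) + pair_force (a + c + s) = 1 / 2 * ln ((l (a + 1) - l c) / (l (a - 1) - l c))"
      "0 < (l (a + 1) - l c) / (l (a - 1) - l c)"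
      by (simp_all only: pair_force_def ln_mult_pos mult_pos_pos) (simp add: algebra_simps)
    have "l (a - 1) - l c = (a - c - 1) * (a + c + s - 1)" by (simp add: l_def algebra_simps)
    then show "l (a - 1) - l c < 0 \<longleftrightarrow> a + 1 < c" "l (a - 1) - l c \<noteq> 0"
      using that assms by (auto simp: mult_less_0_iff)
  qed
  have c: "0 < c" "c < a - 1 \<or> a + 1 < c" and c': "0 < c'" "c' < a - 1 \<or> a + 1 < c'" using assms by auto
  have "l c \<le> l c'" unfolding l_def using assms by (intro mult_mono) auto
  moreover have "l (a - 1) < l (a + 1)" using assms by (simp add: l_def algebra_simps)
  ultimately have "(l (a - 1) - l (a + 1)) * (l c' - l c) \<le> 0" by (intro mult_nonpos_nonneg) auto
  then have *: "(l (a + 1) - l c) * (l (a - 1) - l c') \<le> (l (a + 1) - l c') * (l (a - 1) - l c)"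
    by (simp add: algebra_simps)
  \<comment> \<open>Since \<open>c\<close> and \<open>c'\<close> lie on the same side of
    \<open>a\<close>, the two denominators have equal sign, and clearing them preserves the
    inequality.\<close>
  have "0 < (l (a - 1) - l c) * (l (a - 1) - l c')"
    using assms(5)
  proof
    assume "c' < a - 1"
    then show ?thesis using neg[OF c] nz[OF c] neg[OF c'] nz[OF c'] assms(3) by (intro mult_pos_pos) auto
  next
    assume "a + 1 < c"
    then show ?thesis using neg[OF c] neg[OF c'] assms(3) by (intro mult_neg_neg) auto
  qed
  then have "(l (a + 1) - l c) / (l (a - 1) - l c) \<le> (l (a + 1) - l c') / (l (a - 1) - l c')"
    using * nz[OF c] nz[OF c'] by (simp add: frac_le_eq divide_nonpos_pos)
  then show ?thesis using pos[OF c] pos[OF c'] unfolding ln[OF c] ln[OF c'] by simp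
qed

text \<open>Balance at a positive root, each other root taken together with its mirror image. The
  image of \<open>x j\<close> itself is left over and contributes the single term.\<close>

lemma (in dual_hahn) positive_root_equation:
  assumes "bij_betw x K Apos" "j \<in> K" "finite K"
  shows "(\<Sum>k\<in>K - {j}. pair_force (x j - x k) + pair_force (x j + x k + \<sigma>)) + pair_force (2 * x j + \<sigma>) + F (x j) = 0"
proof -
  have xj: "x j \<in> Apos" using assms bij_betwE by blast
  have "Z - {x j} = (Apos - {x j}) \<union> mirror ` Apos" using xj Z_disjoint by (auto simp: Z_def)
  then have "- F (x j) = (\<Sum>c\<in>(Apos - {x j}) \<union> mirror ` Apos. pair_force (x j - c))"
    using force_critical[of "x j"] xj by (simp add: Z_def)
  also have "\<dots> = (\<Sum>c\<in>Apos - {x j}. pair_force (x j - c)) + (\<Sum>c\<in>mirror ` Apos. pair_force (x j - c))"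
    using Apos_card Z_disjoint by (intro sum.union_disjoint) auto
  also have "(\<Sum>c\<in>mirror ` Apos. pair_force (x j - c)) = (\<Sum>c\<in>Apos. pair_force (x j + c + \<sigma>))"
    by (subst sum.reindex) (auto simp: mirror_def inj_on_subset[OF mirror_inj] algebra_simps)
  also have "\<dots> = pair_force (x j + x j + \<sigma>) + (\<Sum>c\<in>Apos - {x j}. pair_force (x j + c + \<sigma>))"
    by (rule sum.remove[OF Apos_card(1) xj])
  finally have "- F (x j) = (\<Sum>c\<in>Apos - {x j}. pair_force (x j - c) + pair_force (x j + c + \<sigma>)) + pair_force (2 * x j + \<sigma>)"
    by (simp add: sum.distrib)
  also have "(\<Sum>c\<in>Apos - {x j}. pair_force (x j - c) + pair_force (x j + c + \<sigma>)) =
      (\<Sum>k\<in>K - {j}. pair_force (x j - x k) + pair_force (x j + x k + \<sigma>))"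
  proof (rule sum.reindex_bij_betw[symmetric])
    show "bij_betw x (K - {j}) (Apos - {x j})"
      using assms inj_on_image_set_diff[of x K K "{j}"] by (auto simp: bij_betw_def inj_on_diff)
  qed
  finally show ?thesis by simp
qed

text \<open>\<open>N\<close> enters only through the quotient \<open>g\<close>, which is 1 minus a
  positive fraction that shrinks as \<open>N\<close> grows.\<close>

lemma force_increasing_N:
  assumes "0 \<le> \<gamma>" "0 \<le> \<delta>" "0 < x" "x < real N" "N < M"
  shows "dual_hahn_force \<gamma> \<delta> N x < dual_hahn_force \<gamma> \<delta> M x"
proof -
  define c where "c = ((x + \<gamma> + 1) * (x + \<gamma> + \<delta> + 1) * (2 * x + \<gamma> + \<delta>)) / (x * (x + \<delta>) * (2 * x + \<gamma> + \<delta> + 2))"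
  define g where "g K = (real K - x) / (x + \<gamma> + \<delta> + real K + 1)" for K :: nat
  have c: "0 < c" unfolding c_def using assms by (intro divide_pos_pos mult_pos_pos) auto
  have force: "dual_hahn_force \<gamma> \<delta> K x = 1 / 2 * ln (c * g K)" for K
    by (simp add: dual_hahn_force_def c_def g_def mult_ac)
  have "0 < g N" using assms by (simp add: g_def)
  moreover have "g N < g M"
  proof -
    have g: "g K = 1 - (2 * x + \<gamma> + \<delta> + 1) / (x + \<gamma> + \<delta> + real K + 1)" for K
      unfolding g_def using assms by (simp add: field_simps)
    have "(2 * x + \<gamma> + \<delta> + 1) / (x + \<gamma> + \<delta> + real M + 1) < (2 * x + \<gamma> + \<delta> + 1) / (x + \<gamma> + \<delta> + real N + 1)"
      using assms by (intro divide_strict_left_mono mult_pos_pos) auto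
    then show ?thesis unfolding g by simp
  qed
  ultimately show ?thesis unfolding force using c by simp
qed

text \<open>Maximum principle: at an index maximizing \<open>x j - z j \<ge> 0\<close>, every force acting on the root \<open>x j\<close> would
  be at most the corresponding force on \<open>z j\<close>, and the external one strictly smaller.\<close>

lemma positive_roots_less:
  assumes "0 \<le> \<gamma>" "0 \<le> \<delta>" "1 \<le> n" "n \<le> N" "N < M"
    and x: "bij_betw x K (dual_hahn.Apos n N \<gamma> \<delta>)" and z: "bij_betw z K (dual_hahn.Apos n M \<gamma> \<delta>)"
    and ord: "\<And>j k. j \<in> K \<Longrightarrow> k \<in> K \<Longrightarrow> x j < x k \<longleftrightarrow> z j < z k"
    and K: "finite K" "i \<in> K"
  shows "x i < z i"
proof (rule ccontr)
  assume i: "\<not> x i < z i"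
  interpret X: dual_hahn n N \<gamma> \<delta> by unfold_locales (use assms in auto)
  interpret Z: dual_hahn n M \<gamma> \<delta> by unfold_locales (use assms in auto)
  define s where "s = \<gamma> + \<delta> + 1"
  have s: "X.\<sigma> = s" "Z.\<sigma> = s" "1 \<le> s" using assms by (simp_all add: X.\<sigma>_def Z.\<sigma>_def s_def)
  define m where "m = Max ((\<lambda>k. x k - z k) ` K)"
  have "m \<in> (\<lambda>k. x k - z k) ` K" unfolding m_def using K by (intro Max_in) auto
  then obtain j where j: "j \<in> K" "x j = z j + m" by auto
  have le: "x k \<le> z k + m" if "k \<in> K" for k
  proof -
    have "x k - z k \<le> m" unfolding m_def using K that by (intro Max_ge) auto
    then show ?thesis by simp
  qed
  have m: "0 \<le> m" using le[OF K(2)] i by simp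
  have xp: "0 < x k" "x k < real N" if "k \<in> K" for k
    using x that X.AposD bij_betwE by blast+
  have zp: "0 < z k" if "k \<in> K" for k
    using z that Z.AposD bij_betwE by blast
  have pairs: "pair_force (x j - x k) + pair_force (x j + x k + s)
      \<le> pair_force (z j - z k) + pair_force (z j + z k + s)" if k: "k \<in> K - {j}" for k
  proof -
    have "x k \<noteq> x j" "z k \<noteq> z j" using x z k j(1) by (auto simp: bij_betw_def dest: inj_onD)
    moreover have "x k \<in> X.Z" "x j \<in> X.Z" "z k \<in> Z.Z" "z j \<in> Z.Z"
      using x z k j(1) bij_betwE by (auto simp: X.Z_def Z.Z_def)
    ultimately have "1 < \<bar>x k - x j\<bar>" "1 < \<bar>z k - z j\<bar>" using X.Z_separated Z.Z_separated by blast+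
    moreover have "x k < x j \<longleftrightarrow> z k < z j" using ord k j(1) by blast
    ultimately have "z k + m < x j - 1 \<or> x j + 1 < x k" unfolding j(2) by linarith
    \<comment> \<open>Two moves: \<open>x k\<close> is raised to \<open>z k + m\<close> with
      \<open>x j\<close> fixed, then both points shift left by \<open>m\<close>, which keeps their
      difference and changes only the mirrored term. Maximality of \<open>m\<close> makes the first
      move go to the right, and separation keeps it out of the excluded zone around
      \<open>x j\<close>.\<close>
    then have "pair_force (x j - x k) + pair_force (x j + x k + s)
        \<le> pair_force (x j - (z k + m)) + pair_force (x j + (z k + m) + s)"
      using xp[of k] xp[OF j(1)] k le[of k] s by (intro mirrored_pair_force_mono) auto
    also have "x j - (z k + m) = z j - z k" by (simp add: j(2))
    also have "pair_force (x j + (z k + m) + s) \<le> pair_force (z j + z k + s)"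
      using zp[of k] zp[OF j(1)] k m s by (intro pair_force_antimono) (auto simp: j(2))
    finally show ?thesis by simp
  qed
  then have "(\<Sum>k\<in>K - {j}. pair_force (x j - x k) + pair_force (x j + x k + s))
      \<le> (\<Sum>k\<in>K - {j}. pair_force (z j - z k) + pair_force (z j + z k + s))"
    by (rule sum_mono)
  moreover have "pair_force (2 * x j + s) \<le> pair_force (2 * z j + s)"
    using zp[OF j(1)] m s by (intro pair_force_antimono) (auto simp: j(2))
  moreover have "dual_hahn_force \<gamma> \<delta> N (x j) \<le> dual_hahn_force \<gamma> \<delta> N (z j)"
    using X.force_decreasing_pos[of "z j" "x j"] zp[OF j(1)] xp[OF j(1)] m j(2) by (cases "m = 0") auto
  moreover have "dual_hahn_force \<gamma> \<delta> N (z j) < dual_hahn_force \<gamma> \<delta> M (z j)"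
    using zp[OF j(1)] xp[OF j(1)] m j(2) assms by (intro force_increasing_N) auto
  ultimately show False
    using X.positive_root_equation[OF x j(1) K(1)] Z.positive_root_equation[OF z j(1) K(1)]
    unfolding s by linarith
qed

section \<open>Labelled positive roots and complex roots\<close>

context dual_hahn begin

lemma dual_hahn_roots_eq: "dual_hahn_roots n \<gamma> \<delta> N = Z"
  by (auto simp: dual_hahn_roots_def poly_Y_eq_0_iff Y_def[symmetric])

lemma positive_root_bij: "bij_betw (positive_root n \<gamma> \<delta> N) {1..n} Apos"
  and positive_root_less: "j \<in> {1..n} \<Longrightarrow> k \<in> {1..n} \<Longrightarrow> j < k \<Longrightarrow> positive_root n \<gamma> \<delta> N j < positive_root n \<gamma> \<delta> N k"
proof -
  have eq: "positive_root n \<gamma> \<delta> N = (\<lambda>j. sorted_list_of_set Apos ! (j - 1))"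
    by (simp add: positive_root_def[abs_def] dual_hahn_roots_eq Z_parts)
  show less: "positive_root n \<gamma> \<delta> N j < positive_root n \<gamma> \<delta> N k"
    if "j \<in> {1..n}" "k \<in> {1..n}" "j < k" for j k
    unfolding eq using that Apos_card strict_sorted_list_of_set[of Apos]
    by (intro sorted_wrt_nth_less[of "(<)"]) auto
  have inj: "inj_on (positive_root n \<gamma> \<delta> N) {1..n}"
    by (rule linorder_inj_onI') (use less in force)
  have "positive_root n \<gamma> \<delta> N j \<in> Apos" if "j \<in> {1..n}" for j
    using nth_mem[of "j - 1" "sorted_list_of_set Apos"] that Apos_card by (auto simp: eq)
  then have "positive_root n \<gamma> \<delta> N ` {1..n} \<subseteq> Apos" by blast
  then have "positive_root n \<gamma> \<delta> N ` {1..n} = Apos"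
    using Apos_card inj by (intro card_subset_eq) (auto simp: card_image)
  then show "bij_betw (positive_root n \<gamma> \<delta> N) {1..n} Apos" using inj by (simp add: bij_betw_def)
qed

text \<open>The real factorization has \<open>2 * n\<close> distinct linear factors; read over the
  complex numbers it leaves no room for further or multiple roots.\<close>

lemma complex_roots:
  defines "P \<equiv> cpoly Y"
  shows "degree P = 2 * n" "card {z. poly P z = 0} = 2 * n"
    "poly P z = 0 \<Longrightarrow> z \<in> \<real> \<and> order z P = 1"
proof -
  obtain c where c: "c \<noteq> 0" "Y = smult c (\<Prod>a\<in>Z. [:- a, 1:])" using Y_factorization by blast
  have Q: "cpoly (\<Prod>a\<in>S. [:- a, 1:]) = (\<Prod>a\<in>S. [:- complex_of_real a, 1:])" if "finite S" for S
    using that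
  proof (induction S)
    case (insert a S)
    have "cpoly [:- a, 1:] = [:- complex_of_real a, 1:]" by (simp add: map_poly_pCons)
    then show ?case by (simp only: prod.insert[OF insert.hyps] cpoly_mult insert.IH)
  qed simp
  have P: "P = smult (complex_of_real c) (\<Prod>a\<in>Z. [:- complex_of_real a, 1:])"
  proof -
    have "Y = [:c:] * (\<Prod>a\<in>Z. [:- a, 1:])" using c by simp
    then have "P = cpoly [:c:] * cpoly (\<Prod>a\<in>Z. [:- a, 1:])" by (simp only: P_def cpoly_mult)
    then show ?thesis using Z_card(1) by (simp add: Q map_poly_pCons)
  qed
  show "degree P = 2 * n"
    using Z_card c(1) by (simp add: P degree_prod_eq_sum_degree)
  have roots: "poly P z = 0 \<longleftrightarrow> z \<in> complex_of_real ` Z" for z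
    using Z_card(1) c(1) by (auto simp: P poly_prod)
  then have "{z. poly P z = 0} = complex_of_real ` Z" by auto
  then show "card {z. poly P z = 0} = 2 * n" using Z_card by (simp add: card_image inj_on_def)
  assume "poly P z = 0"
  then obtain a where a: "a \<in> Z" "z = complex_of_real a" using roots by auto
  define q where "q = smult (complex_of_real c) (\<Prod>a\<in>Z - {a}. [:- complex_of_real a, 1:])"
  have Pq: "P = [:- z, 1:] * q"
    unfolding P q_def a(2) using prod.remove[OF Z_card(1) a(1), of "\<lambda>a. [:- complex_of_real a, 1:]"]
    by (simp only: mult_smult_right)
  have "poly q z \<noteq> 0" using Z_card(1) c(1) by (auto simp: q_def poly_prod a(2))
  moreover from this have "P \<noteq> 0" unfolding Pq by (intro no_zero_divisors) auto
  ultimately have "order z P = 1"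
    using order_mult[of "[:- z, 1:]" q z] order_power_n_n[of z 1] by (simp add: Pq order_0I)
  then show "z \<in> \<real> \<and> order z P = 1" using a(2) by simp
qed

end

theorem mainTheorem13:
  fixes n N :: nat and \<gamma> \<delta> :: real
  assumes "0 \<le> \<gamma>" and "0 \<le> \<delta>" and "1 \<le> n" and "n \<le> N"
  shows "let P = map_poly complex_of_real (dual_hahn_lambda n \<gamma> \<delta> N);
             Z = dual_hahn_roots n \<gamma> \<delta> N;
             I = {0<..<real N};
             J = {- real N - \<gamma> - \<delta> - 1<..<- \<gamma> - \<delta> - 1}
         in degree P = 2 * n \<and> card {z. poly P z = 0} = 2 * n \<and>
            (\<forall>z. poly P z = 0 \<longrightarrow> z \<in> \<real> \<and> order z P = 1) \<and>
            Z \<subseteq> I \<union> J \<and> card (Z \<inter> I) = n \<and> card (Z \<inter> J) = n \<and>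
            (\<forall>x\<in>Z. \<forall>y\<in>Z. x \<noteq> y \<longrightarrow> \<bar>x - y\<bar> > 1) \<and>
            (\<forall>\<phi>. dual_hahn_field \<gamma> \<delta> N \<phi> \<longrightarrow>
               (\<forall>x. equilibrium_distribution \<phi> n 0 (real N) (- real N - \<gamma> - \<delta> - 1) (- \<gamma> - \<delta> - 1) x \<longleftrightarrow>
                    bij_betw x {1..n} (Z \<inter> I) \<and> bij_betw x {n+1..2*n} (Z \<inter> J))) \<and>
            (\<forall>j\<in>{1..n}. strict_mono_on {n..} (\<lambda>M. positive_root n \<gamma> \<delta> M j))"
proof -
  interpret dual_hahn n N \<gamma> \<delta> by unfold_locales (use assms in auto)
  have mono: "positive_root n \<gamma> \<delta> M j < positive_root n \<gamma> \<delta> M' j"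
    if "j \<in> {1..n}" "n \<le> M" "M < M'" for j M M'
  proof (rule positive_roots_less[OF assms(1-3) that(2,3), where K = "{1..n}" and i = j and
        x = "positive_root n \<gamma> \<delta> M" and z = "positive_root n \<gamma> \<delta> M'"])
    interpret X: dual_hahn n M \<gamma> \<delta> by unfold_locales (use assms that in auto)
    interpret X': dual_hahn n M' \<gamma> \<delta> by unfold_locales (use assms that in auto)
    show "bij_betw (positive_root n \<gamma> \<delta> M) {1..n} X.Apos" "bij_betw (positive_root n \<gamma> \<delta> M') {1..n} X'.Apos"
      by (rule X.positive_root_bij X'.positive_root_bij)+
    fix i k assume "i \<in> {1..n}" "k \<in> {1..n}"
    then show "positive_root n \<gamma> \<delta> M i < positive_root n \<gamma> \<delta> M k \<longleftrightarrow>
        positive_root n \<gamma> \<delta> M' i < positive_root n \<gamma> \<delta> M' k"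
      using X.positive_root_less[of i k] X.positive_root_less[of k i]
        X'.positive_root_less[of i k] X'.positive_root_less[of k i]
      by (cases i k rule: linorder_cases) auto
  qed (use that in auto)
  have cards: "card (Z \<inter> I) = n" "card (Z \<inter> J) = n"
    unfolding Z_parts using Apos_card card_image[OF inj_on_subset[OF mirror_inj], of Apos] by auto
  show ?thesis
    unfolding Let_def dual_hahn_roots_eq Y_def[symmetric]
    using complex_roots cards Z_parts(3) Z_separated equilibrium_iff_arrangement mono
    by (auto simp: arrangement_def strict_mono_on_def)
qed

end
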